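(* Let $R>0$ and let the Poincaré half-plane $\Pi_P=\{\xi=\xi_{\rm r}+i\xi_{\rm im}\in\mathbb C:\xi_{\rm im}>0\}$ be endowed with the symplectic form $\omega_{\Pi_P}=\dfrac{R}{\xi_{\rm im}^2}\,d\xi_{\rm r}\wedge d\xi_{\rm im}$ and with the Hamiltonian action of $SL(2,\mathbb R)$ by Möbius transformations. With $\mathfrak{sl}(2,\mathbb R)$ and its dual identified with the vector space $\mathbf F$, with an admissible basis $(\mathbf e_x,\mathbf e_y,\mathbf e_z)$, the moment map of this action is $$J_{\Pi_P}(\xi)=\frac{R}{2\xi_{\rm im}}\bigl((1-|\xi|^2)\mathbf e_x+2\xi_{\rm r}\mathbf e_y+(1+|\xi|^2)\mathbf e_z\bigr).$$ The set $\Omega$ of generalized temperatures is the set of time-like elements of $\mathbf F\equiv\mathfrak{sl}(2,\mathbb R)$ directed towards the past. Let $\boldsymbol\beta\in\Omega$ and let the admissible basis be chosen such that $\boldsymbol\beta=\beta\mathbf e_z$ with $\beta<0$. The probability density, with respect to the Liouville measure $\lambda_{\omega_{\Pi_P}}$, of the Gibbs state indexed by $\boldsymbol\beta$ is $$\rho_{\boldsymbol\beta}(\xi)=\frac{|\beta|}{2\pi}\exp\left(-\frac{R|\beta|\bigl((1+\xi_{\rm im})^2+\xi_{\rm r}^2\bigr)}{2\xi_{\rm im}}\right),\qquad \xi=\xi_{\rm r}+i\xi_{\rm im}\in\Pi_P,$$ and the associated thermodynamic functions are, with $\Vert\boldsymbol\beta\Vert=\sqrt{-\boldsymbol\beta\cdot\boldsymbol\beta}=|\beta|$,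 $$E_J(\boldsymbol\beta)=-\frac{1+R\Vert\boldsymbol\beta\Vert}{\Vert\boldsymbol\beta\Vert^2}\,\boldsymbol\beta,\qquad S(\boldsymbol\beta)=1+\log\frac{2\pi}{\Vert\boldsymbol\beta\Vert}.$$
   Context: $\mathbf F$ is a three-dimensional real vector space endowed with a scalar product $\cdot$ of signature $(+,+,-)$, an orientation and a temporal orientation (choice of one of the two connected components of the set of non-zero vectors $\mathbf v$ with $\mathbf v\cdot\mathbf v\le0$; its elements are directed towards the future, those of the other component towards the past). Time-like means $\mathbf v\cdot\mathbf v<0$. An admissible basis is a positively oriented orthogonal basis with $\mathbf e_x\cdot\mathbf e_x=\mathbf e_y\cdot\mathbf e_y=1$, $\mathbf e_z\cdot\mathbf e_z=-1$, $\mathbf e_z$ directed towards the future. $G\cong SO(2,1)$ is the group of linear automorphisms of $\mathbf F$ preserving these structures, $\mathfrak g$ its Lie algebra. $\mathbf F$ is identified with $\mathfrak g$ (the matrix of the endomorphism corresponding to $a\mathbf e_x+b\mathbf e_y+c\mathbf e_z$ being $\begin{pmatrix}0&-c&b\\ c&0&-a\\ b&-a&0\end{pmatrix}$ in any admissible basis), and with $\mathfrak g^*$ via the scalar product, so $\langle\mathbf r,\boldsymbol\beta\rangle=\mathbf r\cdot\boldsymbol\beta$. $P_R^+=\{x\mathbf e_x+y\mathbf e_y+z\mathbf e_z: z=\sqrt{R^2+x^2+y^2}\}$ is a coadjoint orbit of $G$, with symplectic form $dz\wedge d\varphi$ ($\varphi$ the polar angle of $(x,y)$), and with the canonical injection into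 $\mathbf F\equiv\mathfrak g^*$ as moment map of the coadjoint action (which is the natural action of $G$). Let $D_P=\{w\in\mathbb C:|w|<1\}$, $\psi_R:P_R^+\to D_P$, $\psi_R(x\mathbf e_x+y\mathbf e_y+\sqrt{R^2+x^2+y^2}\,\mathbf e_z)=\frac{x+iy}{R+\sqrt{R^2+x^2+y^2}}$, and $U_M:D_P\to\Pi_P$, $U_M(w)=\frac{i(1-w)}{1+w}$. The form $\omega_{\Pi_P}$ is the one for which $U_M\circ\psi_R:P_R^+\to\Pi_P$ is a symplectomorphism. A matrix $\begin{pmatrix}p&q\\ r&s\end{pmatrix}\in SL(2,\mathbb R)$ acts on $\Pi_P$ by $\xi\mapsto\frac{p\xi+q}{r\xi+s}$; transported to $P_R^+$ by $(U_M\circ\psi_R)^{-1}$, this action is the restriction to $P_R^+$ of a unique element of $G$, which defines a surjective homomorphism $SL(2,\mathbb R)\to G$ with kernel $\{\pm1\}$, hence an isomorphism $\mathfrak{sl}(2,\mathbb R)\cong\mathfrak g\equiv\mathbf F$; this is the identification of $\mathfrak{sl}(2,\mathbb R)$ (and dually of $\mathfrak{sl}(2,\mathbb R)^*$) with $\mathbf F$, and the moment map is the one corresponding to the canonical injection of $P_R^+$, i.e. $J_{\Pi_P}=(U_M\circ\psi_R)^{-1}$. The Liouville measure is $\lambda_{\omega_{\Pi_P}}(d\xi)=\frac{R}{\xi_{\rm im}^2}d\xi_{\rm r}d\xi_{\rm im}$. Definitions (for a moment map $J:M\to\mathfrak g^*$ on a symplectic manifold $M$ with Liouville measure $\lambda$):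 $\boldsymbol\beta\in\mathfrak g$ is a generalized temperature if there exist an open neighbourhood $U$ of $\boldsymbol\beta$ in $\mathfrak g$ and a $\lambda$-integrable function $f:M\to\mathbb R^+$ with $\exp(-\langle J(x),\boldsymbol\beta'\rangle)\le f(x)$ for all $\boldsymbol\beta'\in U$, $x\in M$. $\Omega$ is the set of generalized temperatures. For $\boldsymbol\beta\in\Omega$: $P(\boldsymbol\beta)=\int_M\exp(-\langle J(x),\boldsymbol\beta\rangle)\lambda(dx)$; the Gibbs state indexed by $\boldsymbol\beta$ is the probability measure of density $\rho_{\boldsymbol\beta}(x)=P(\boldsymbol\beta)^{-1}\exp(-\langle J(x),\boldsymbol\beta\rangle)$ with respect to $\lambda$; $E_J(\boldsymbol\beta)=\int_M J\rho_{\boldsymbol\beta}\,d\lambda\in\mathfrak g^*$ (mean value of the moment map); $S(\boldsymbol\beta)=-\int_M\rho_{\boldsymbol\beta}\log\rho_{\boldsymbol\beta}\,d\lambda$ (entropy).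
   Formalization: The density is proved with (1 − ξ_im)² in place of the printed (1 + ξ_im)², because the printed expression is exp(−2R|β|) times the Gibbs density, so its total mass is less than 1 and it is not a probability density. *)

theory Defs
  imports "HOL-Probability.Probability"
begin

section \<open>Oriented three-dimensional Lorentzian vector spaces\<close>

text \<open>
  The space \<open>F\<close> is a type \<open>'f\<close> of dimension 3. Its class \<^class>\<open>euclidean_space\<close> only supplies
  the vector space topology; the scalar product under study is the indefinite form \<open>B\<close>.
  Ordered bases are indexed by the type \<^typ>\<open>3\<close>, so that \<open>e 1\<close>, \<open>e 2\<close>, \<open>e 3\<close> are
  \<open>e\<^sub>x\<close>, \<open>e\<^sub>y\<close>, \<open>e\<^sub>z\<close>.
\<close>

definition is_basis :: "(3 \<Rightarrow> 'f::euclidean_space) \<Rightarrow> bool" where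
  "is_basis e \<longleftrightarrow> inj e \<and> independent (range e) \<and> span (range e) = UNIV"

definition lorentz_orthonormal ::
    "('f::euclidean_space \<Rightarrow> 'f \<Rightarrow> real) \<Rightarrow> (3 \<Rightarrow> 'f) \<Rightarrow> bool" where
  "lorentz_orthonormal B e \<longleftrightarrow> is_basis e \<and> (\<forall>i j. i \<noteq> j \<longrightarrow> B (e i) (e j) = 0) \<and>
     B (e 1) (e 1) = 1 \<and> B (e 2) (e 2) = 1 \<and> B (e 3) (e 3) = -1"

definition same_orientation :: "(3 \<Rightarrow> 'f::euclidean_space) \<Rightarrow> (3 \<Rightarrow> 'f) \<Rightarrow> bool" where
  "same_orientation e e' \<longleftrightarrow>
     (\<exists>A :: real^3^3. det A > 0 \<and> (\<forall>j. e' j = (\<Sum>i\<in>UNIV. (A $ i $ j) *\<^sub>R e i)))"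

text \<open>An orientation is represented by the set of its positively oriented bases.\<close>

definition is_orientation :: "(3 \<Rightarrow> 'f::euclidean_space) set \<Rightarrow> bool" where
  "is_orientation Or \<longleftrightarrow> (\<exists>e. is_basis e \<and> Or = {e'. same_orientation e e'})"

definition causal_vectors :: "('f::euclidean_space \<Rightarrow> 'f \<Rightarrow> real) \<Rightarrow> 'f set" where
  "causal_vectors B = {v. v \<noteq> 0 \<and> B v v \<le> 0}"

definition lorentz_space ::
    "('f::euclidean_space \<Rightarrow> 'f \<Rightarrow> real) \<Rightarrow> (3 \<Rightarrow> 'f) set \<Rightarrow> 'f set \<Rightarrow> bool" where
  "lorentz_space B Or Fut \<longleftrightarrow>
     DIM('f) = 3 \<and> bilinear B \<and> (\<forall>u v. B u v = B v u) \<and> (\<exists>e. lorentz_orthonormal B e) \<and>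
     is_orientation Or \<and> Fut \<in> components (causal_vectors B)"

definition timelike :: "('f::euclidean_space \<Rightarrow> 'f \<Rightarrow> real) \<Rightarrow> 'f \<Rightarrow> bool" where
  "timelike B v \<longleftrightarrow> B v v < 0"

definition past_directed ::
    "('f::euclidean_space \<Rightarrow> 'f \<Rightarrow> real) \<Rightarrow> 'f set \<Rightarrow> 'f \<Rightarrow> bool" where
  "past_directed B Fut v \<longleftrightarrow> v \<in> causal_vectors B - Fut"

definition lnorm :: "('f::euclidean_space \<Rightarrow> 'f \<Rightarrow> real) \<Rightarrow> 'f \<Rightarrow> real" where
  "lnorm B v = sqrt (- B v v)"

definition admissible_basis ::
    "('f::euclidean_space \<Rightarrow> 'f \<Rightarrow> real) \<Rightarrow> (3 \<Rightarrow> 'f) set \<Rightarrow> 'f set \<Rightarrow> (3 \<Rightarrow> 'f) \<Rightarrow> bool" where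
  "admissible_basis B Or Fut e \<longleftrightarrow> lorentz_orthonormal B e \<and> e \<in> Or \<and> e 3 \<in> Fut"

definition lorentz_group ::
    "('f::euclidean_space \<Rightarrow> 'f \<Rightarrow> real) \<Rightarrow> (3 \<Rightarrow> 'f) set \<Rightarrow> 'f set \<Rightarrow> ('f \<Rightarrow> 'f) set" where
  "lorentz_group B Or Fut = {g. linear g \<and> bij g \<and> (\<forall>u v. B (g u) (g v) = B u v) \<and>
     (\<forall>b\<in>Or. g \<circ> b \<in> Or) \<and> g ` Fut = Fut}"

text \<open>
  The identification of \<open>F\<close> with the Lie algebra of the group, \<open>v\<close> being sent to
  \<open>lie_endo B e v\<close>. For an admissible basis \<open>e\<close>, \<open>lcoords B e v\<close> are the coordinates of \<open>v\<close>.
\<close>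

definition lcoords ::
    "('f::euclidean_space \<Rightarrow> 'f \<Rightarrow> real) \<Rightarrow> (3 \<Rightarrow> 'f) \<Rightarrow> 'f \<Rightarrow> real^3" where
  "lcoords B e v = vector [B v (e 1), B v (e 2), - B v (e 3)]"

definition lie_matrix :: "real^3 \<Rightarrow> real^3^3" where
  "lie_matrix v = vector [vector [0, - (v$3), v$2], vector [v$3, 0, - (v$1)], vector [v$2, - (v$1), 0]]"

definition lie_endo ::
    "('f::euclidean_space \<Rightarrow> 'f \<Rightarrow> real) \<Rightarrow> (3 \<Rightarrow> 'f) \<Rightarrow> 'f \<Rightarrow> 'f \<Rightarrow> 'f" where
  "lie_endo B e v w = (\<Sum>i\<in>UNIV. ((lie_matrix (lcoords B e v) *v lcoords B e w) $ i) *\<^sub>R e i)"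

section \<open>Generalized temperatures and Gibbs states\<close>

text \<open>
  The dual of the Lie algebra is identified with \<open>'f\<close> through \<open>B\<close>, so the pairing of
  \<open>J x\<close> with \<open>\<beta>\<close> is \<open>B (J x) \<beta>\<close>.
\<close>

definition generalized_temperatures ::
    "('f::euclidean_space \<Rightarrow> 'f \<Rightarrow> real) \<Rightarrow> 'm measure \<Rightarrow> ('m \<Rightarrow> 'f) \<Rightarrow> 'f set" where
  "generalized_temperatures B M J = {\<beta>. \<exists>U f. open U \<and> \<beta> \<in> U \<and> integrable M f \<and>
     (\<forall>x\<in>space M. 0 \<le> f x) \<and> (\<forall>\<beta>'\<in>U. \<forall>x\<in>space M. exp (- B (J x) \<beta>') \<le> (f x :: real))}"

definition partition_function ::
    "('f::euclidean_space \<Rightarrow> 'f \<Rightarrow> real) \<Rightarrow> 'm measure \<Rightarrow> ('m \<Rightarrow> 'f) \<Rightarrow> 'f \<Rightarrow> real" where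
  "partition_function B M J \<beta> = (\<integral>x. exp (- B (J x) \<beta>) \<partial>M)"

definition gibbs_density ::
    "('f::euclidean_space \<Rightarrow> 'f \<Rightarrow> real) \<Rightarrow> 'm measure \<Rightarrow> ('m \<Rightarrow> 'f) \<Rightarrow> 'f \<Rightarrow> 'm \<Rightarrow> real" where
  "gibbs_density B M J \<beta> x = exp (- B (J x) \<beta>) / partition_function B M J \<beta>"

definition mean_moment ::
    "('f::euclidean_space \<Rightarrow> 'f \<Rightarrow> real) \<Rightarrow> 'm measure \<Rightarrow> ('m \<Rightarrow> 'f) \<Rightarrow> 'f \<Rightarrow> 'f" where
  "mean_moment B M J \<beta> = (\<integral>x. gibbs_density B M J \<beta> x *\<^sub>R J x \<partial>M)"

definition entropy_integrand ::
    "('f::euclidean_space \<Rightarrow> 'f \<Rightarrow> real) \<Rightarrow> 'm measure \<Rightarrow> ('m \<Rightarrow> 'f) \<Rightarrow> 'f \<Rightarrow> 'm \<Rightarrow> real" where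
  "entropy_integrand B M J \<beta> x = gibbs_density B M J \<beta> x * ln (gibbs_density B M J \<beta> x)"

definition gibbs_entropy ::
    "('f::euclidean_space \<Rightarrow> 'f \<Rightarrow> real) \<Rightarrow> 'm measure \<Rightarrow> ('m \<Rightarrow> 'f) \<Rightarrow> 'f \<Rightarrow> real" where
  "gibbs_entropy B M J \<beta> = - (\<integral>x. entropy_integrand B M J \<beta> x \<partial>M)"

section \<open>The half-plane with its symplectic form and the Moebius action\<close>

definition half_plane :: "complex set" where
  "half_plane = {\<xi>. Im \<xi> > 0}"

text \<open>The form \<open>R / (Im \<xi>)\<^sup>2 d(Re \<xi>) \<and> d(Im \<xi>)\<close> at \<open>\<xi>\<close>, evaluated on the tangent vectors \<open>u\<close>, \<open>v\<close>.\<close>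

definition half_plane_form :: "real \<Rightarrow> complex \<Rightarrow> complex \<Rightarrow> complex \<Rightarrow> real" where
  "half_plane_form R \<xi> u v = R / (Im \<xi>)\<^sup>2 * (Re u * Im v - Im u * Re v)"

definition liouville_measure ::
    "complex set \<Rightarrow> (complex \<Rightarrow> complex \<Rightarrow> complex \<Rightarrow> real) \<Rightarrow> complex measure" where
  "liouville_measure U \<omega> = restrict_space (density lborel (\<lambda>\<xi>. ennreal \<bar>\<omega> \<xi> 1 \<i>\<bar>)) U"

definition SL2 :: "(real^2^2) set" where
  "SL2 = {A. det A = 1}"

definition sl2 :: "(real^2^2) set" where
  "sl2 = {X. trace X = 0}"

definition moebius_act :: "real^2^2 \<Rightarrow> complex \<Rightarrow> complex" where
  "moebius_act A \<xi> = (of_real (A$1$1) * \<xi> + of_real (A$1$2)) / (of_real (A$2$1) * \<xi> + of_real (A$2$2))"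

text \<open>Curves in \<^const>\<open>SL2\<close> through the identity representing the tangent vector \<open>X\<close>.\<close>

definition SL2_curve :: "real^2^2 \<Rightarrow> (real \<Rightarrow> real^2^2) \<Rightarrow> bool" where
  "SL2_curve X \<gamma> \<longleftrightarrow> (\<forall>t. \<gamma> t \<in> SL2) \<and> \<gamma> 0 = mat 1 \<and> (\<gamma> has_vector_derivative X) (at 0)"

definition fundamental_field :: "real^2^2 \<Rightarrow> complex \<Rightarrow> complex" where
  "fundamental_field X \<xi> = (THE u. \<forall>\<gamma>. SL2_curve X \<gamma> \<longrightarrow>
     ((\<lambda>t. moebius_act (\<gamma> t) \<xi>) has_vector_derivative u) (at 0))"

section \<open>The orbit, its projection to the half-plane, and the identification of sl(2) with F\<close>

definition orbit_P :: "real \<Rightarrow> (3 \<Rightarrow> 'f::euclidean_space) \<Rightarrow> 'f set" where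
  "orbit_P R e = {x *\<^sub>R e 1 + y *\<^sub>R e 2 + sqrt (R\<^sup>2 + x\<^sup>2 + y\<^sup>2) *\<^sub>R e 3 | x y. True}"

definition psi ::
    "real \<Rightarrow> ('f::euclidean_space \<Rightarrow> 'f \<Rightarrow> real) \<Rightarrow> (3 \<Rightarrow> 'f) \<Rightarrow> 'f \<Rightarrow> complex" where
  "psi R B e v = (let x = lcoords B e v $ 1; y = lcoords B e v $ 2
     in Complex x y / of_real (R + sqrt (R\<^sup>2 + x\<^sup>2 + y\<^sup>2)))"

definition U_M :: "complex \<Rightarrow> complex" where
  "U_M w = \<i> * (1 - w) / (1 + w)"

definition J_half_plane ::
    "real \<Rightarrow> ('f::euclidean_space \<Rightarrow> 'f \<Rightarrow> real) \<Rightarrow> (3 \<Rightarrow> 'f) \<Rightarrow> complex \<Rightarrow> 'f" where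
  "J_half_plane R B e = inv_into (orbit_P R e) (U_M \<circ> psi R B e)"

text \<open>
  The homomorphism from \<^const>\<open>SL2\<close> obtained by transporting the Moebius action to the orbit, and
  its differential at the identity, which identifies \<^const>\<open>sl2\<close> with \<open>'f\<close>.
\<close>

definition SL2_hom ::
    "real \<Rightarrow> ('f::euclidean_space \<Rightarrow> 'f \<Rightarrow> real) \<Rightarrow> (3 \<Rightarrow> 'f) set \<Rightarrow> 'f set \<Rightarrow> (3 \<Rightarrow> 'f) \<Rightarrow>
     real^2^2 \<Rightarrow> 'f \<Rightarrow> 'f" where
  "SL2_hom R B Or Fut e A = (THE g. g \<in> lorentz_group B Or Fut \<and>
     (\<forall>\<xi>\<in>half_plane. g (J_half_plane R B e \<xi>) = J_half_plane R B e (moebius_act A \<xi>)))"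

definition sl2_ident ::
    "real \<Rightarrow> ('f::euclidean_space \<Rightarrow> 'f \<Rightarrow> real) \<Rightarrow> (3 \<Rightarrow> 'f) set \<Rightarrow> 'f set \<Rightarrow> (3 \<Rightarrow> 'f) \<Rightarrow>
     real^2^2 \<Rightarrow> 'f" where
  "sl2_ident R B Or Fut e X = (THE v. \<forall>\<gamma>. SL2_curve X \<gamma> \<longrightarrow>
     (\<forall>w. ((\<lambda>t. SL2_hom R B Or Fut e (\<gamma> t) w) has_vector_derivative lie_endo B e v w) (at 0)))"

text \<open>
  The Hamiltonian of \<open>X\<close> is the pairing of \<open>J\<close> with \<open>X\<close>, regarded as a vector \<open>\<iota> X\<close> of \<open>'f\<close>.
  Sign convention: the contraction of \<open>\<omega>\<close> with the generator of \<open>\<xi> \<mapsto> exp (t X) \<xi>\<close> is \<open>+ d \<langle>J, X\<rangle>\<close>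
  (equivalently \<open>- d \<langle>J, X\<rangle>\<close> for the generator of \<open>exp (- t X)\<close>). It is the convention for which
  the canonical injection is the moment map on the orbit with the form \<open>dz \<and> d\<phi>\<close>: the rotations
  about \<open>e\<^sub>z\<close> have generator \<open>d/d\<phi>\<close>, whose contraction is \<open>- dz\<close>, and \<open>r \<cdot> e\<^sub>z = - z\<close>.
\<close>

definition is_moment_map ::
    "('f::euclidean_space \<Rightarrow> 'f \<Rightarrow> real) \<Rightarrow> (real^2^2 \<Rightarrow> 'f) \<Rightarrow> complex set \<Rightarrow>
     (complex \<Rightarrow> complex \<Rightarrow> complex \<Rightarrow> real) \<Rightarrow> (complex \<Rightarrow> 'f) \<Rightarrow> bool" where
  "is_moment_map B \<iota> M \<omega> J \<longleftrightarrow> (\<forall>X\<in>sl2. \<forall>\<xi>\<in>M.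
     ((\<lambda>\<zeta>. B (J \<zeta>) (\<iota> X)) has_derivative \<omega> \<xi> (fundamental_field X \<xi>)) (at \<xi>))"

end

theory Submission
  imports Defs
begin

text \<open>
  The chart is explicit in both directions. For \<open>v = (x, y, z)\<close> on the orbit, clearing denominators
  with \<open>x\<^sup>2 + y\<^sup>2 = z\<^sup>2 - R\<^sup>2\<close> gives \<open>U_M (psi v) = (y + i R) / (x + z)\<close> (\<open>chart_eq\<close>), and solving for \<open>v\<close>
  gives the formula for the moment map (\<open>J_formula\<close>).

  The group SL(2) acts on Lorentz vectors through the symmetric matrices
  \<open>S(v) = ((z - x, y), (y, z + x))\<close>, whose determinant is minus the Lorentz form, by \<open>S \<mapsto> A S A\<^sup>T\<close>. For
  \<open>v = J \<xi>\<close> this matrix is \<open>R / Im \<xi>\<close> times \<open>((\<bar>\<xi>\<bar>\<^sup>2, Re \<xi>), (Re \<xi>, 1))\<close>, so that \<open>J\<close> intertwines the Moebius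
  action with this action (\<open>J_equivariant\<close>). As the values of \<open>J\<close> span the space, the homomorphism
  into the Lorentz group is this action (\<open>SL2_hom_eq\<close>); differentiating it at the identity identifies
  \<open>((p, q), (r, -p))\<close> with \<open>(-(q + r), -2 p, q - r)\<close> (\<open>sl2_ident_eq\<close>), and the moment map equation becomes
  the differentiation of an explicit function of two real variables (\<open>moment_map\<close>).

  The pairing of \<open>J \<xi>\<close> with \<open>\<beta>\<close> is, up to the factor \<open>-R / (2 Im \<xi>)\<close>, a quadratic polynomial in \<open>Re \<xi>\<close> and
  \<open>Im \<xi>\<close>. If \<open>\<beta>\<close> is not time-like and past-directed, an arbitrarily small perturbation of \<open>\<beta>\<close> makes
  this polynomial positive at a point of the real axis; then the Gibbs weight is at least 1 near
  that point, where the Liouville measure is infinite (\<open>generalized_timelike_past\<close>). Conversely, past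
  time-like vectors form an open cone, and near each of them the weight is dominated by a function
  \<open>exp (-\<epsilon> z)\<close> (\<open>timelike_past_generalized\<close>).

  The affine maps \<open>\<xi> \<mapsto> t + h \<xi>\<close> preserve the Liouville measure (\<open>hp_invariant\<close>) and suffice to bring every
  past time-like \<open>\<beta>\<close> to the form \<open>-k e\<^sub>z\<close> with \<open>k = \<parallel>\<beta>\<parallel>\<close> (\<open>rest_frame\<close>), so all integrals are needed in that
  case only. There, with \<open>s = \<surd>y - 1/\<surd>y\<close> for \<open>\<xi> = x + i y\<close>, the height \<open>z\<close> of \<open>J \<xi>\<close> satisfies
  \<open>z - R = (R/2) (x\<^sup>2/y + s\<^sup>2)\<close>. The integral over \<open>x\<close> is Gaussian, and the substitution \<open>y \<mapsto> s\<close> turns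
  the remaining one into another Gaussian integral (\<open>hp_gibbs_integral\<close>). Partition function, mean and
  entropy are read off from it.
\<close>

section \<open>Bases and orientations\<close>

lemma is_basis_linear:
  assumes "is_basis b" "linear g" "bij g"
  shows "is_basis (g \<circ> b)"
proof -
  have inj: "inj g" and surj: "surj g" using assms by (auto simp: bij_def)
  have r: "range (g \<circ> b) = g ` range b" by auto
  have "span (g ` range b) = g ` span (range b)" using assms(2) by (rule linear_span_image)
  moreover have "independent (g ` range b)"
    using assms inj by (intro linear_independent_injective_image) (auto simp: is_basis_def)
  ultimately show ?thesis unfolding is_basis_def r using assms(1) inj surj
    by (auto simp: is_basis_def intro: inj_compose)
qed

lemma same_orientation_trans:
  assumes "same_orientation a b" "same_orientation b c"
  shows "same_orientation a c"
proof -
  obtain A where A: "det A > 0" "\<And>j. b j = (\<Sum>i\<in>UNIV. (A $ i $ j) *\<^sub>R a i)"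
    using assms(1) by (auto simp: same_orientation_def)
  obtain C where C: "det C > 0" "\<And>j. c j = (\<Sum>i\<in>UNIV. (C $ i $ j) *\<^sub>R b i)"
    using assms(2) by (auto simp: same_orientation_def)
  have "c j = (\<Sum>i\<in>UNIV. ((A ** C) $ i $ j) *\<^sub>R a i)" for j
  proof -
    have "c j = (\<Sum>k\<in>UNIV. \<Sum>i\<in>UNIV. (C $ k $ j * A $ i $ k) *\<^sub>R a i)"
      by (simp add: C(2) A(2) scaleR_sum_right)
    also have "\<dots> = (\<Sum>i\<in>UNIV. \<Sum>k\<in>UNIV. (C $ k $ j * A $ i $ k) *\<^sub>R a i)" by (rule sum.swap)
    finally show ?thesis
      by (simp add: matrix_matrix_mult_def scaleR_sum_left mult.commute)
  qed
  moreover have "det (A ** C) > 0" using A C by (simp add: det_mul)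
  ultimately show ?thesis unfolding same_orientation_def by blast
qed

lemma same_orientation_sym:
  assumes "same_orientation a b"
  shows "same_orientation b a"
proof -
  obtain A where A: "det A > 0" "\<And>j. b j = (\<Sum>i\<in>UNIV. (A $ i $ j) *\<^sub>R a i)"
    using assms by (auto simp: same_orientation_def)
  have "invertible A" using A(1) by (simp add: invertible_det_nz)
  then obtain C where C: "A ** C = mat 1" by (auto simp: invertible_def)
  have "det A * det C = 1" using C by (metis det_mul det_I)
  hence dC: "det C > 0" using A(1) by (metis less_numeral_extra(1) zero_less_mult_pos)
  have "a j = (\<Sum>i\<in>UNIV. (C $ i $ j) *\<^sub>R b i)" for j
  proof -
    have "(\<Sum>i\<in>UNIV. (C $ i $ j) *\<^sub>R b i) = (\<Sum>k\<in>UNIV. \<Sum>i\<in>UNIV. (C $ k $ j * A $ i $ k) *\<^sub>R a i)"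
      by (simp add: A(2) scaleR_sum_right)
    also have "\<dots> = (\<Sum>i\<in>UNIV. \<Sum>k\<in>UNIV. (C $ k $ j * A $ i $ k) *\<^sub>R a i)" by (rule sum.swap)
    also have "\<dots> = (\<Sum>i\<in>UNIV. ((A ** C) $ i $ j) *\<^sub>R a i)"
      by (simp add: matrix_matrix_mult_def scaleR_sum_left mult.commute)
    also have "\<dots> = (\<Sum>i\<in>UNIV. (if i = j then a i else 0))"
      unfolding C by (intro sum.cong) (auto simp: mat_def)
    finally show ?thesis by simp
  qed
  with dC show ?thesis unfolding same_orientation_def by blast
qed

text \<open>An orientation is an equivalence class, so any of its members may serve as reference basis.\<close>
lemma orientation_eq:
  assumes "is_orientation Or" "b \<in> Or"
  shows "Or = {c. same_orientation b c}"
  using assms same_orientation_trans same_orientation_sym unfolding is_orientation_def by blast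

lemma orientation_linear:
  assumes "is_orientation Or" "a \<in> Or" "linear g" "same_orientation a (g \<circ> a)" "b \<in> Or"
  shows "g \<circ> b \<in> Or"
proof -
  have "same_orientation a b" using assms orientation_eq by blast
  hence "same_orientation (g \<circ> a) (g \<circ> b)"
    unfolding same_orientation_def using assms(3)
    by (auto simp: linear_sum linear_cmul linear_scale)
  thus ?thesis using orientation_eq[OF assms(1,2)] same_orientation_trans[OF assms(4)] by blast
qed

section \<open>Coordinates in a Lorentz frame\<close>

lemma SL2_iff: "A \<in> SL2 \<longleftrightarrow> A$1$1 * A$2$2 - A$1$2 * A$2$1 = 1"
  by (simp add: SL2_def det_2)

locale lorentz_frame =
  fixes B :: "'f::euclidean_space \<Rightarrow> 'f \<Rightarrow> real" and e :: "3 \<Rightarrow> 'f"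
  assumes bilinear: "bilinear B" and sym: "B u v = B v u" and orth: "lorentz_orthonormal B e"
begin

definition cx :: "'f \<Rightarrow> real" where "cx v = B v (e 1)"
definition cy :: "'f \<Rightarrow> real" where "cy v = B v (e 2)"
definition cz :: "'f \<Rightarrow> real" where "cz v = - B v (e 3)"

definition fvec :: "real \<Rightarrow> real \<Rightarrow> real \<Rightarrow> 'f" where
  "fvec x y z = x *\<^sub>R e 1 + y *\<^sub>R e 2 + z *\<^sub>R e 3"

lemma B_simps: "B (u + v) w = B u w + B v w" "B w (u + v) = B w u + B w v"
   "B (c *\<^sub>R u) w = c * B u w" "B w (c *\<^sub>R u) = c * B w u"
   "B (- u) w = - B u w" "B w (- u) = - B w u" "B (u - v) w = B u w - B v w" 
   "B w (u - v) = B w u - B w v" "B 0 w = 0" "B w 0 = 0"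
  using bilinear by (simp_all add: bilinear_ladd bilinear_radd bilinear_lmul bilinear_rmul
     bilinear_lneg bilinear_rneg bilinear_lsub bilinear_rsub bilinear_lzero bilinear_rzero)

lemma B_frame: "B (e 1) (e 1) = 1" "B (e 2) (e 2) = 1" "B (e 3) (e 3) = -1"
   "B (e 1) (e 2) = 0" "B (e 1) (e 3) = 0" "B (e 2) (e 1) = 0" "B (e 2) (e 3) = 0"
   "B (e 3) (e 1) = 0" "B (e 3) (e 2) = 0"
  using orth by (auto simp: lorentz_orthonormal_def)

lemma coord_linear [simp]: 
  "cx (u + v) = cx u + cx v" "cy (u + v) = cy u + cy v" "cz (u + v) = cz u + cz v"
  "cx (u - v) = cx u - cx v" "cy (u - v) = cy u - cy v" "cz (u - v) = cz u - cz v"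
  "cx (c *\<^sub>R v) = c * cx v" "cy (c *\<^sub>R v) = c * cy v" "cz (c *\<^sub>R v) = c * cz v"
  "cx (- v) = - cx v" "cy (- v) = - cy v" "cz (- v) = - cz v"
  "cx 0 = 0" "cy 0 = 0" "cz 0 = 0"
  by (simp_all add: cx_def cy_def cz_def B_simps)

lemma coord_frame [simp]:
  "cx (e 1) = 1" "cy (e 1) = 0" "cz (e 1) = 0" "cx (e 2) = 0" "cy (e 2) = 1" "cz (e 2) = 0"
  "cx (e 3) = 0" "cy (e 3) = 0" "cz (e 3) = 1"
  by (simp_all add: cx_def cy_def cz_def B_frame)

lemma coord_fvec [simp]: "cx (fvec x y z) = x" "cy (fvec x y z) = y" "cz (fvec x y z) = z"
  by (simp_all add: fvec_def)

lemma fvec_coord: "fvec (cx v) (cy v) (cz v) = v"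
proof -
  have b: "is_basis e" using orth by (simp add: lorentz_orthonormal_def)
  hence "v \<in> span (range e)" by (auto simp: is_basis_def)
  then obtain c where "v = (\<Sum>w\<in>range e. c w *\<^sub>R w)"
    using span_finite[of "range e"] by auto
  also have "\<dots> = (\<Sum>i\<in>UNIV. c (e i) *\<^sub>R e i)"
    using b by (subst sum.reindex) (auto simp: is_basis_def)
  finally have "v = fvec (c (e 1)) (c (e 2)) (c (e 3))" by (simp add: sum_3 fvec_def)
  thus ?thesis by (metis coord_fvec)
qed

lemma vec_eq: "u = v \<longleftrightarrow> cx u = cx v \<and> cy u = cy v \<and> cz u = cz v"
  by (metis fvec_coord)

lemma B_coord: "B u v = cx u * cx v + cy u * cy v - cz u * cz v"
proof -
  have "B u v = B u (fvec (cx v) (cy v) (cz v))" by (simp add: fvec_coord)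
  also have "\<dots> = cx u * cx v + cy u * cy v - cz u * cz v"
    unfolding fvec_def B_simps by (simp add: cx_def cy_def cz_def)
  finally show ?thesis .
qed

lemma bounded_linear_coord: "bounded_linear cx" "bounded_linear cy" "bounded_linear cz"
  by (intro linear_conv_bounded_linear[THEN iffD1] linearI; simp)+

lemma lcoords_coord: "lcoords B e v = vector [cx v, cy v, cz v]"
  by (simp add: lcoords_def cx_def cy_def cz_def)

lemma lie_endo_coord:
  "lie_endo B e v w = fvec (cy v * cz w - cz v * cy w) (cz v * cx w - cx v * cz w)
     (cy v * cx w - cx v * cy w)"
  by (simp add: lie_endo_def lie_matrix_def lcoords_coord sum_3 matrix_vector_mult_def fvec_def
     algebra_simps)

text \<open>
  A causal vector with vanishing last coordinate would have a vanishing Euclidean norm, so the last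
  coordinate separates the future from the past.
\<close>
lemma causal_cz: "v \<in> causal_vectors B \<longleftrightarrow> cz v \<noteq> 0 \<and> (cx v)\<^sup>2 + (cy v)\<^sup>2 \<le> (cz v)\<^sup>2"
proof -
  have "v = 0" if "(cx v)\<^sup>2 + (cy v)\<^sup>2 \<le> (cz v)\<^sup>2" "cz v = 0"
    using that by (simp add: vec_eq sum_power2_le_zero_iff)
  moreover have "B v v \<le> 0 \<longleftrightarrow> (cx v)\<^sup>2 + (cy v)\<^sup>2 \<le> (cz v)\<^sup>2"
    by (simp add: B_coord power2_eq_square)
  ultimately show ?thesis by (auto simp: causal_vectors_def)
qed

text \<open>
  The causal vectors with positive last coordinate form a convex set, hence a connected one, and no
  connected set of causal vectors can leave it because the last coordinate would have to vanish.
\<close>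
lemma future_eq:
  assumes "Fut \<in> components (causal_vectors B)" "e 3 \<in> Fut"
  shows "Fut = {v \<in> causal_vectors B. cz v > 0}" (is "_ = ?C")
proof
  have eC: "e 3 \<in> ?C" by (simp add: causal_cz)
  have cv: "v \<in> ?C \<longleftrightarrow> cz v > 0 \<and> cmod (Complex (cx v) (cy v)) \<le> cz v" for v
  proof (cases "cz v > 0")
    case True
    hence "cmod (Complex (cx v) (cy v)) \<le> cz v \<longleftrightarrow> (cmod (Complex (cx v) (cy v)))\<^sup>2 \<le> (cz v)\<^sup>2"
      by (simp add: power_mono_iff)
    thus ?thesis using True by (simp add: causal_cz cmod_power2)
  qed simp
  have "convex ?C"
  proof (rule convexI)
    fix u v and a b :: real assume uv: "u \<in> ?C" "v \<in> ?C" and ab: "0 \<le> a" "0 \<le> b" "a + b = 1"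
    have "cmod (Complex (cx (a *\<^sub>R u + b *\<^sub>R v)) (cy (a *\<^sub>R u + b *\<^sub>R v)))
       = cmod (of_real a * Complex (cx u) (cy u) + of_real b * Complex (cx v) (cy v))"
      by (rule arg_cong[of _ _ cmod]) (simp add: complex_eq_iff)
    also have "\<dots> \<le> a * cmod (Complex (cx u) (cy u)) + b * cmod (Complex (cx v) (cy v))"
      by (rule order_trans[OF norm_triangle_ineq]) (use ab in \<open>simp add: norm_mult\<close>)
    also have "\<dots> \<le> a * cz u + b * cz v"
      using cv[THEN iffD1, OF uv(1)] cv[THEN iffD1, OF uv(2)] ab by (intro add_mono mult_left_mono) simp_all
    finally have 1: "cmod (Complex (cx (a *\<^sub>R u + b *\<^sub>R v)) (cy (a *\<^sub>R u + b *\<^sub>R v))) \<le> cz (a *\<^sub>R u + b *\<^sub>R v)"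
      by simp
    have "0 < a * cz u + b * cz v"
    proof (cases "a = 0")
      case True thus ?thesis using ab uv by simp
    next
      case False thus ?thesis using ab uv by (intro add_pos_nonneg mult_pos_pos mult_nonneg_nonneg) auto
    qed
    with 1 show "a *\<^sub>R u + b *\<^sub>R v \<in> ?C" unfolding cv by simp
  qed
  hence "connected ?C" by (rule convex_connected)
  thus "?C \<subseteq> Fut"
    using components_maximal[OF assms(1), of ?C] eC assms(2) by blast
  show "Fut \<subseteq> ?C"
  proof
    fix v assume v: "v \<in> Fut"
    have sub: "Fut \<subseteq> causal_vectors B" using assms(1) by (rule in_components_subset)
    have "connected (cz ` Fut)"
      using bounded_linear_coord(3) in_components_connected[OF assms(1)]
      by (intro connected_continuous_image linear_continuous_on)
    hence "is_interval (cz ` Fut)" by (simp add: is_interval_connected_1)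
    moreover have "cz v \<in> cz ` Fut" "1 \<in> cz ` Fut" using v assms(2) by (auto intro: image_eqI[of _ _ "e 3"])
    moreover have "0 \<notin> cz ` Fut" using sub by (auto simp: causal_cz)
    ultimately have "\<not> cz v \<le> 0" unfolding is_interval_1 by force
    thus "v \<in> ?C" using v sub by auto
  qed
qed

section \<open>The action of SL(2) on Lorentz vectors\<close>

text \<open>
  The map \<open>S \<mapsto> A S A\<^sup>T\<close> on symmetric matrices, a vector being encoded by the matrix \<open>S\<close> with rows
  \<open>(u, y)\<close> and \<open>(y, t)\<close> in the null coordinates \<open>u = z - x\<close>, \<open>t = z + x\<close>.
\<close>
definition act :: "real^2^2 \<Rightarrow> 'f \<Rightarrow> 'f" where
  "act A v = (let p = A$1$1; q = A$1$2; r = A$2$1; s = A$2$2;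
      u = cz v - cx v; y = cy v; t = cz v + cx v;
      u' = p\<^sup>2 * u + 2 * p * q * y + q\<^sup>2 * t; 
      t' = r\<^sup>2 * u + 2 * r * s * y + s\<^sup>2 * t
    in fvec ((t' - u') / 2) (p * r * u + (p * s + q * r) * y + q * s * t) ((u' + t') / 2))"

lemma act_null:
  "cz (act A v) - cx (act A v) = (A$1$1)\<^sup>2 * (cz v - cx v) + 2 * A$1$1 * A$1$2 * cy v + (A$1$2)\<^sup>2 * (cz v + cx v)"
  "cz (act A v) + cx (act A v) = (A$2$1)\<^sup>2 * (cz v - cx v) + 2 * A$2$1 * A$2$2 * cy v + (A$2$2)\<^sup>2 * (cz v + cx v)"
  "cy (act A v) = A$1$1 * A$2$1 * (cz v - cx v) + (A$1$1 * A$2$2 + A$1$2 * A$2$1) * cy v + A$1$2 * A$2$2 * (cz v + cx v)"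
  by (simp_all add: act_def Let_def field_simps)

lemma vec_eq_null: "u = v \<longleftrightarrow> cz u - cx u = cz v - cx v \<and> cy u = cy v \<and> cz u + cx u = cz v + cx v"
  by (auto simp: vec_eq)

lemma B_null: 
  "2 * B u v = 2 * cy u * cy v - (cz u - cx u) * (cz v + cx v) - (cz u + cx u) * (cz v - cx v)"
  by (simp add: B_coord algebra_simps)

lemma linear_act: "linear (act A)"
  by (rule linearI)
    (simp_all add: act_def Let_def vec_eq algebra_simps add_divide_distrib diff_divide_distrib)

text \<open>The Lorentz form is minus the determinant of \<open>S\<close>, which \<open>S \<mapsto> A S A\<^sup>T\<close> multiplies by \<open>(det A)\<^sup>2 = 1\<close>.\<close>
lemma act_B:
  assumes "A \<in> SL2" shows "B (act A u) (act A v) = B u v"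
proof -
  obtain p q r s where A: "A$1$1 = p" "A$1$2 = q" "A$2$1 = r" "A$2$2 = s" by blast
  have 1: "p * s - q * r = 1" using assms A by (simp add: SL2_iff)
  have eq: "2 * (p * r * a + (p * s + q * r) * b + q * s * c) * (p * r * a' + (p * s + q * r) * b' + q * s * c')
     - (p\<^sup>2 * a + 2 * p * q * b + q\<^sup>2 * c) * (r\<^sup>2 * a' + 2 * r * s * b' + s\<^sup>2 * c')
     - (r\<^sup>2 * a + 2 * r * s * b + s\<^sup>2 * c) * (p\<^sup>2 * a' + 2 * p * q * b' + q\<^sup>2 * c')
     = (p * s - q * r)\<^sup>2 * (2 * b * b' - a * c' - c * a')" for a b c a' b' c' :: real
    by (simp add: algebra_simps power2_eq_square)
  have "2 * B (act A u) (act A v) = (p * s - q * r)\<^sup>2 * (2 * B u v)"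
    unfolding B_null act_null A by (rule eq)
  thus ?thesis using 1 by simp
qed

lemma bij_act:
  assumes "A \<in> SL2" shows "bij (act A)"
proof -
  have "inj (act A)"
  proof (rule linear_injective_0[OF linear_act, THEN iffD2], intro allI impI)
    fix v assume 0: "act A v = 0"
    hence "B v w = 0" for w using act_B[OF assms, of v w] by (simp add: B_simps)
    from this[of "e 1"] this[of "e 2"] this[of "e 3"] show "v = 0"
      by (simp add: vec_eq cx_def cy_def cz_def B_simps)
  qed
  thus ?thesis using linear_injective_imp_surjective[OF linear_act] by (simp add: bij_def)
qed

lemma act_orientation:
  assumes "A \<in> SL2" shows "same_orientation e (act A \<circ> e)"
proof -
  obtain p q r s where A: "A$1$1 = p" "A$1$2 = q" "A$2$1 = r" "A$2$2 = s" by blast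
  define G :: "real^3^3" where "G = (\<chi> i j. vector [cx (act A (e j)), cy (act A (e j)), cz (act A (e j))] $ i)"
  \<comment> \<open>Passing to the null coordinates removes the denominators of the action.\<close>
  have half: "2 * (x1*y2*z3 + x2*y3*z1 + x3*y1*z2 - x1*y3*z2 - x2*y1*z3 - x3*y2*z1)
      = (z1+x1)*y2*(z3-x3) + (z2+x2)*y3*(z1-x1) + (z3+x3)*y1*(z2-x2) 
        - (z1+x1)*y3*(z2-x2) - (z2+x2)*y1*(z3-x3) - (z3+x3)*y2*(z1-x1)" 
    for x1 x2 x3 y1 y2 y3 z1 z2 z3 :: real
    by (simp add: algebra_simps)
  define x y z where "x i = cx (act A (e i))" and "y i = cy (act A (e i))" and "z i = cz (act A (e i))" for i
  have "2 * det G = 2 * (x 1*y 2*z 3 + x 2*y 3*z 1 + x 3*y 1*z 2 - x 1*y 3*z 2 - x 2*y 1*z 3 - x 3*y 2*z 1)"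
    unfolding det_3 G_def by (simp add: x_def y_def z_def)
  also have "\<dots> = 2 * (p * s - q * r)^3"
    unfolding half unfolding x_def y_def z_def act_null A coord_frame
    by (simp add: algebra_simps power2_eq_square power3_eq_cube)
  finally have "det G = (p * s - q * r)^3" by simp
  hence "det G > 0" using assms A by (simp add: SL2_iff)
  moreover have "(act A \<circ> e) j = (\<Sum>i\<in>UNIV. (G $ i $ j) *\<^sub>R e i)" for j
    by (simp add: sum_3 G_def vec_eq)
  ultimately show ?thesis unfolding same_orientation_def by blast
qed

text \<open>
  The diagonal entries of \<open>A S A\<^sup>T\<close> are values of the quadratic form \<open>S\<close>, which is positive semidefinite
  for a causal vector directed towards the future.
\<close>
lemma act_future:
  assumes "A \<in> SL2" "v \<in> causal_vectors B" "cz v > 0"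
  shows "act A v \<in> causal_vectors B" "cz (act A v) > 0"
proof -
  obtain p q r s where A: "A$1$1 = p" "A$1$2 = q" "A$2$1 = r" "A$2$2 = s" by blast
  have "act A v \<noteq> 0" using bij_act[OF assms(1)] linear_act assms(2)
    by (metis (mono_tags, lifting) bij_betw_imp_inj_on causal_vectors_def injD linear_0 mem_Collect_eq)
  thus c: "act A v \<in> causal_vectors B" using assms by (simp add: causal_vectors_def act_B)
  define u y t where d: "u = cz v - cx v" "y = cy v" "t = cz v + cx v"
  have ut: "y\<^sup>2 \<le> u * t" "u + t > 0" using assms(2,3) by (auto simp: causal_cz d power2_eq_square algebra_simps)
  have quad: "a\<^sup>2 * u + 2 * a * b * y + b\<^sup>2 * t \<ge> 0" for a b :: real
  proof -
    have "u * (a\<^sup>2 * u + 2 * a * b * y + b\<^sup>2 * t) = (a * u + b * y)\<^sup>2 + b\<^sup>2 * (u * t - y\<^sup>2)"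
      "t * (a\<^sup>2 * u + 2 * a * b * y + b\<^sup>2 * t) = (b * t + a * y)\<^sup>2 + a\<^sup>2 * (u * t - y\<^sup>2)"
      by (simp_all add: power2_eq_square algebra_simps)
    hence "u * (a\<^sup>2 * u + 2 * a * b * y + b\<^sup>2 * t) \<ge> 0" "t * (a\<^sup>2 * u + 2 * a * b * y + b\<^sup>2 * t) \<ge> 0"
      using ut by simp_all
    moreover have "u > 0 \<or> t > 0" using ut by linarith
    ultimately show ?thesis by (auto simp: zero_le_mult_iff)
  qed
  have "cz (act A v) \<ge> 0" using quad[of p q] quad[of r s]
    by (simp add: act_def A Let_def flip: d)
  moreover have "cz (act A v) \<noteq> 0" using c by (simp add: causal_cz)
  ultimately show "cz (act A v) > 0" by simp
qed

lemma act_lorentz_group: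
  assumes "A \<in> SL2" "is_orientation Or" "e \<in> Or" "Fut \<in> components (causal_vectors B)" "e 3 \<in> Fut"
  shows "act A \<in> lorentz_group B Or Fut"
proof -
  note F = future_eq[OF assms(4,5)]
  have "act A ` Fut = Fut"
  proof
    show "act A ` Fut \<subseteq> Fut" using act_future[OF assms(1)] by (auto simp: F)
    show "Fut \<subseteq> act A ` Fut"
    proof
      fix w assume w: "w \<in> Fut"
      obtain v where v: "w = act A v" using bij_act[OF assms(1)] by (metis bij_pointE)
      have vc: "v \<in> causal_vectors B" using w linear_0[OF linear_act]
        by (auto simp: F v causal_vectors_def act_B[OF assms(1)])
      have "cz v > 0"
      proof (rule ccontr)
        assume "\<not> cz v > 0"
        hence "cz (- v) > 0" "- v \<in> causal_vectors B" using vc by (auto simp: causal_cz)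
        from act_future(2)[OF assms(1) this(2,1)] show False 
          using w by (simp add: linear_neg[OF linear_act] F flip: v)
      qed
      thus "w \<in> act A ` Fut" using v vc by (auto simp: F)
    qed
  qed
  thus ?thesis unfolding lorentz_group_def
    using linear_act bij_act[OF assms(1)] act_B[OF assms(1)]
       orientation_linear[OF assms(2,3) linear_act act_orientation[OF assms(1)]] by blast
qed

lemma act_admissible:
  assumes "A \<in> SL2" "is_orientation Or" "admissible_basis B Or Fut e" "Fut \<in> components (causal_vectors B)"
  shows "admissible_basis B Or Fut (act A \<circ> e)"
proof -
  have e: "e \<in> Or" "e 3 \<in> Fut" using assms(3) by (auto simp: admissible_basis_def)
  have "act A \<in> lorentz_group B Or Fut" using act_lorentz_group[OF assms(1,2) e(1) assms(4) e(2)] .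
  hence "act A \<circ> e \<in> Or" "act A (e 3) \<in> Fut" using e by (auto simp: lorentz_group_def)
  moreover have "lorentz_orthonormal B (act A \<circ> e)"
    using orth act_B[OF assms(1)] is_basis_linear[OF _ linear_act bij_act[OF assms(1)]]
    by (auto simp: lorentz_orthonormal_def)
  ultimately show ?thesis by (simp add: admissible_basis_def)
qed

end

section \<open>The Liouville measure of the half-plane\<close>

abbreviation (input) hp_measure :: "real \<Rightarrow> complex measure" where
  "hp_measure R \<equiv> liouville_measure half_plane (half_plane_form R)"

text \<open>
  The imaginary part comes first in the product, so that iterated integrals have the Gaussian
  integration over the real part inside.
\<close>
lemma lborel_complex: "(lborel :: complex measure) = distr (lborel \<Otimes>\<^sub>M lborel) borel (\<lambda>(y, x). Complex x y)"
proof (rule lborel_eqI)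
  have [measurable]: "(\<lambda>(y, x). Complex x y) \<in> borel_measurable (lborel \<Otimes>\<^sub>M lborel)"
    unfolding lborel_prod by (auto intro!: borel_measurable_continuous_onI continuous_intros simp: case_prod_unfold)
  fix l u :: complex assume lu: "\<And>b. b \<in> Basis \<Longrightarrow> l \<bullet> b \<le> u \<bullet> b"
  have *: "Re l \<le> Re u" "Im l \<le> Im u" using lu[of 1] lu[of \<i>] by (simp_all add: Basis_complex_def inner_complex_def)
  have eq: "(\<lambda>(y, x). Complex x y) -` box l u \<inter> space (lborel \<Otimes>\<^sub>M lborel) = {Im l<..<Im u} \<times> {Re l<..<Re u}"
    by (auto simp: box_def Basis_complex_def inner_complex_def space_pair_measure)
  have "emeasure (distr (lborel \<Otimes>\<^sub>M lborel) borel (\<lambda>(y, x). Complex x y)) (box l u)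
      = emeasure (lborel \<Otimes>\<^sub>M lborel) ({Im l<..<Im u} \<times> {Re l<..<Re u})"
    by (subst emeasure_distr) (auto simp: eq)
  also have "\<dots> = ennreal (Im u - Im l) * ennreal (Re u - Re l)"
    using * by (subst lborel.emeasure_pair_measure_Times) simp_all
  also have "\<dots> = (\<Prod>b\<in>Basis. (u - l) \<bullet> b)"
    using * by (simp add: Basis_complex_def inner_complex_def ennreal_mult complex_eq_iff mult.commute)
  finally show "emeasure (distr (lborel \<Otimes>\<^sub>M lborel) borel (\<lambda>(y, x). Complex x y)) (box l u)
    = (\<Prod>b\<in>Basis. (u - l) \<bullet> b)" .
qed simp

lemma half_plane_borel [measurable]: "half_plane \<in> sets borel"
  unfolding half_plane_def by (intro borel_open open_halfspace_Im_gt)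

lemma space_hp [simp]: "space (hp_measure R) = half_plane"
  by (simp add: liouville_measure_def space_restrict_space)

lemma sets_hp: "sets (hp_measure R) = sets (restrict_space borel half_plane)"
  by (simp add: liouville_measure_def sets_restrict_space)

lemma measurable_hp: "f \<in> borel_measurable borel \<Longrightarrow> f \<in> borel_measurable (hp_measure R)"
  unfolding measurable_cong_sets[OF sets_hp refl] by (rule measurable_restrict_space1)

lemma Re_borel [measurable]: "Re \<in> borel_measurable borel" and Im_borel [measurable]: "Im \<in> borel_measurable borel"
  by (intro borel_measurable_continuous_onI continuous_intros)+

lemma Complex_borel [measurable (raw)]: 
  assumes "f \<in> borel_measurable M" "g \<in> borel_measurable M"
  shows "(\<lambda>x. Complex (f x) (g x)) \<in> borel_measurable M"
  using assms by (simp add: borel_measurable_complex_iff)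

lemma nn_integral_hp:
  assumes [measurable]: "f \<in> borel_measurable borel" and R: "R > 0"
  shows "(\<integral>\<^sup>+\<xi>. f \<xi> \<partial>hp_measure R)
    = (\<integral>\<^sup>+y. indicator {0<..} y * ennreal (R / y\<^sup>2) * (\<integral>\<^sup>+x. f (Complex x y) \<partial>lborel) \<partial>lborel)"
proof -
  have form: "half_plane_form R \<xi> 1 \<i> = R / (Im \<xi>)\<^sup>2" for \<xi> by (simp add: half_plane_form_def)
  have "(\<integral>\<^sup>+\<xi>. f \<xi> \<partial>hp_measure R) = (\<integral>\<^sup>+\<xi>. indicator half_plane \<xi> * ennreal (R / (Im \<xi>)\<^sup>2) * f \<xi> \<partial>lborel)"
    unfolding liouville_measure_def form using R
    by (subst nn_integral_restrict_space, simp, subst nn_integral_density, simp_all add: mult_ac)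
  also have "\<dots> = (\<integral>\<^sup>+p. (case p of (y, x) \<Rightarrow> indicator half_plane (Complex x y) * ennreal (R / y\<^sup>2) * f (Complex x y)) \<partial>(lborel \<Otimes>\<^sub>M lborel))"
    by (subst lborel_complex, subst nn_integral_distr) (auto simp: case_prod_unfold)
  also have "\<dots> = (\<integral>\<^sup>+y. \<integral>\<^sup>+x. indicator half_plane (Complex x y) * ennreal (R / y\<^sup>2) * f (Complex x y) \<partial>lborel \<partial>lborel)"
    by (subst lborel.nn_integral_fst[symmetric]) auto
  also have "\<dots> = (\<integral>\<^sup>+y. indicator {0<..} y * ennreal (R / y\<^sup>2) * (\<integral>\<^sup>+x. f (Complex x y) \<partial>lborel) \<partial>lborel)"
    by (intro nn_integral_cong, subst nn_integral_cmult[symmetric])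
       (auto simp: half_plane_def split: split_indicator)
  finally show ?thesis .
qed

lemma hp_affine_measurable:
  assumes "h > 0"
  shows "(\<lambda>\<xi>. Complex (t + c * Re \<xi>) (h * Im \<xi>)) \<in> measurable (hp_measure R) (hp_measure R)"
  unfolding measurable_cong_sets[OF sets_hp sets_hp] 
  by (rule measurable_restrict_space3) (use assms in \<open>auto simp: half_plane_def\<close>)

text \<open>
  With \<open>c = h\<close> these are the Moebius maps fixing infinity; \<open>c = -h\<close> adds the reflections in vertical
  lines, which make the mean of the second coordinate of \<open>J\<close> vanish.
\<close>
lemma hp_invariant:
  assumes R: "R > 0" and h: "h > 0" and c: "\<bar>c\<bar> = h"
  shows "distr (hp_measure R) (hp_measure R) (\<lambda>\<xi>. Complex (t + c * Re \<xi>) (h * Im \<xi>)) = hp_measure R" (is "distr ?M ?M ?T = _")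
proof (rule measure_eqI)
  have T[measurable]: "?T \<in> borel_measurable borel" by simp
  note TM = hp_affine_measurable[OF h]
  fix A assume "A \<in> sets (distr ?M ?M ?T)"
  hence AM: "A \<in> sets ?M" by simp
  hence A[measurable]: "A \<in> sets borel" and AH: "A \<subseteq> half_plane" 
    unfolding sets_hp by (auto simp: sets_restrict_space_iff)
  have "emeasure (distr ?M ?M ?T) A = (\<integral>\<^sup>+\<xi>. indicator A \<xi> \<partial>distr ?M ?M ?T)" using AM by simp
  also have "\<dots> = (\<integral>\<^sup>+\<xi>. indicator A (?T \<xi>) \<partial>?M)" using AM by (intro nn_integral_distr TM) simp
  also have "\<dots> = (\<integral>\<^sup>+y. indicator {0<..} y * ennreal (R / y\<^sup>2) * (\<integral>\<^sup>+x. indicator A (Complex (t + c * x) (h * y)) \<partial>lborel) \<partial>lborel)"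
    using R by (subst nn_integral_hp) simp_all
  also have "\<dots> = (\<integral>\<^sup>+y. ennreal h * (indicator {0<..} (h * y) * ennreal (R / (h * y)\<^sup>2) * (\<integral>\<^sup>+x. indicator A (Complex x (h * y)) \<partial>lborel)) \<partial>lborel)"
  proof (intro nn_integral_cong)
    fix y :: real
    have "(\<integral>\<^sup>+x. indicator A (Complex x (h * y)) \<partial>lborel) = ennreal h * (\<integral>\<^sup>+x. indicator A (Complex (t + c * x) (h * y)) \<partial>lborel)"
      using h c by (subst nn_integral_real_affine[of _ c t]) auto
    moreover have "ennreal (R / y\<^sup>2) = ennreal h * ennreal (R / (h * y)\<^sup>2) * ennreal h"
      using h R by (simp flip: ennreal_mult) (simp add: power2_eq_square)
    moreover have "indicator {0<..} (h * y) = (indicator {0<..} y :: ennreal)"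
      using h by (simp add: indicator_def zero_less_mult_iff)
    ultimately show "indicator {0<..} y * ennreal (R / y\<^sup>2) * (\<integral>\<^sup>+x. indicator A (Complex (t + c * x) (h * y)) \<partial>lborel)
      = ennreal h * (indicator {0<..} (h * y) * ennreal (R / (h * y)\<^sup>2) * (\<integral>\<^sup>+x. indicator A (Complex x (h * y)) \<partial>lborel))"
      by (simp add: mult_ac)
  qed
  also have "\<dots> = ennreal h * (\<integral>\<^sup>+y. (indicator {0<..} (h * y) * ennreal (R / (h * y)\<^sup>2) * (\<integral>\<^sup>+x. indicator A (Complex x (h * y)) \<partial>lborel)) \<partial>lborel)"
    by (subst nn_integral_cmult) auto
  also have "\<dots> = (\<integral>\<^sup>+y. (indicator {0<..} y * ennreal (R / y\<^sup>2) * (\<integral>\<^sup>+x. indicator A (Complex x y) \<partial>lborel)) \<partial>lborel)"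
    using h by (subst nn_integral_real_affine[of _ h 0]) auto
  also have "\<dots> = (\<integral>\<^sup>+\<xi>. indicator A \<xi> \<partial>?M)" using R by (subst nn_integral_hp) simp_all
  also have "\<dots> = emeasure ?M A" using AM by simp
  finally show "emeasure (distr ?M ?M ?T) A = emeasure ?M A" .
qed simp

text \<open>For \<open>0 < h \<le> d\<close> the part below height \<open>h\<close> has measure at least \<open>2 d R / h\<close>, which is unbounded as \<open>h \<rightarrow> 0\<close>.\<close>
lemma infinite_near_boundary:
  assumes R: "R > 0" and d: "d > 0"
  shows "emeasure (hp_measure R) {\<xi>. \<bar>Re \<xi> - a\<bar> < d \<and> 0 < Im \<xi> \<and> Im \<xi> < d} = \<infinity>" (is "emeasure ?M ?A = _")
proof (rule ccontr)
  assume "emeasure ?M ?A \<noteq> \<infinity>"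
  then obtain m where m: "emeasure ?M ?A = ennreal m" "m \<ge> 0" by (cases "emeasure ?M ?A") auto
  define h where "h = min d (R * d / (m + 1))"
  have h: "h > 0" "h \<le> d" "h \<le> R * d / (m + 1)" using R d m by (auto simp: h_def)
  have Am: "?A \<in> sets borel" by measurable
  have AM: "?A \<in> sets ?M" unfolding sets_hp using Am by (auto simp: sets_restrict_space_iff half_plane_def)
  have "ennreal (R / h\<^sup>2 * (2 * d)) * ennreal h = (\<integral>\<^sup>+y. indicator {0<..<h} y * ennreal (R / h\<^sup>2 * (2 * d)) \<partial>lborel)"
    using h by (subst nn_integral_multc) (auto simp: mult.commute)
  also have "\<dots> \<le> (\<integral>\<^sup>+y. indicator {0<..} y * ennreal (R / y\<^sup>2) * (\<integral>\<^sup>+x. indicator ?A (Complex x y) \<partial>lborel) \<partial>lborel)"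
  proof (intro nn_integral_mono)
    fix y :: real
    show "indicator {0<..<h} y * ennreal (R / h\<^sup>2 * (2 * d)) \<le> indicator {0<..} y * ennreal (R / y\<^sup>2) * (\<integral>\<^sup>+x. indicator ?A (Complex x y) \<partial>lborel)"
    proof (cases "0 < y \<and> y < h")
      case True
      have "(\<integral>\<^sup>+x. indicator ?A (Complex x y) \<partial>lborel) = (\<integral>\<^sup>+x. indicator {a - d<..<a + d} x \<partial>lborel)"
        using True h by (intro nn_integral_cong) (auto split: split_indicator simp: abs_if split: if_splits)
      also have "\<dots> = ennreal (2 * d)" using d by simp
      finally have "(\<integral>\<^sup>+x. indicator ?A (Complex x y) \<partial>lborel) = ennreal (2 * d)" .
      moreover have "R / h\<^sup>2 \<le> R / y\<^sup>2" using True R by (intro divide_left_mono) (auto intro: power_mono)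
      hence "ennreal (R / h\<^sup>2 * (2 * d)) \<le> ennreal (R / y\<^sup>2) * ennreal (2 * d)"
        using R d mult_right_mono[of "R / h\<^sup>2" "R / y\<^sup>2" "2 * d"]
        by (subst ennreal_mult[symmetric]) (auto intro!: ennreal_leI)
      ultimately show ?thesis using True by simp
    qed auto
  qed
  also have "\<dots> = (\<integral>\<^sup>+\<xi>. indicator ?A \<xi> \<partial>?M)" using R Am by (subst nn_integral_hp) simp_all
  also have "\<dots> = ennreal m" using AM m by simp
  finally have "ennreal (R / h\<^sup>2 * (2 * d) * h) \<le> ennreal m" using h R d by (subst ennreal_mult) auto
  hence "R / h\<^sup>2 * (2 * d) * h \<le> m" using m by (subst (asm) ennreal_le_iff) auto
  hence "2 * (R * d) \<le> m * h" using h by (simp add: power2_eq_square field_simps)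
  also have "\<dots> \<le> (m + 1) * h" using h by (simp add: mult_right_mono)
  also have "\<dots> \<le> R * d" using h(3) m by (simp add: field_simps)
  finally show False using R d by (simp add: not_le)
qed

section \<open>Gaussian integrals\<close>

lemma gaussian_integral:
  fixes v c0 c1 :: real
  assumes v: "v > 0" and c: "c0 \<ge> 0" "c1 \<ge> 0"
  shows "(\<integral>\<^sup>+x. ennreal ((c0 + c1 * x\<^sup>2) * exp (- x\<^sup>2 / (2 * v))) \<partial>lborel) = ennreal ((c0 + c1 * v) * sqrt (2 * pi * v))"
proof -
  have s: "sqrt v > 0" using v by simp
  let ?n = "normal_density 0 (sqrt v)"
  have n: "?n x = exp (- x\<^sup>2 / (2 * v)) / sqrt (2 * pi * v)" for x
    using v by (simp add: normal_density_def)
  have "has_bochner_integral lborel (\<lambda>x. (c0 * sqrt (2 * pi * v)) * (?n x * (x - 0) ^ (2 * 0)) + (c1 * sqrt (2 * pi * v)) * (?n x * (x - 0) ^ (2 * 1)))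
     ((c0 * sqrt (2 * pi * v)) * (fact (2 * 0) / ((2 / (sqrt v)\<^sup>2)^0 * fact 0)) + (c1 * sqrt (2 * pi * v)) * (fact (2 * 1) / ((2 / (sqrt v)\<^sup>2)^1 * fact 1)))"
    by (intro has_bochner_integral_add has_bochner_integral_mult_right normal_moment_even s)
  also have "(\<lambda>x. (c0 * sqrt (2 * pi * v)) * (?n x * (x - 0) ^ (2 * 0)) + (c1 * sqrt (2 * pi * v)) * (?n x * (x - 0) ^ (2 * 1)))
     = (\<lambda>x. (c0 + c1 * x\<^sup>2) * exp (- x\<^sup>2 / (2 * v)))"
    using v by (simp add: n fun_eq_iff field_simps power2_eq_square)
  also have "(c0 * sqrt (2 * pi * v)) * (fact (2 * 0) / ((2 / (sqrt v)\<^sup>2)^0 * fact 0)) + (c1 * sqrt (2 * pi * v)) * (fact (2 * 1) / ((2 / (sqrt v)\<^sup>2)^1 * fact 1))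
     = (c0 + c1 * v) * sqrt (2 * pi * v)"
    using v by (simp add: field_simps fact_numeral)
  finally have h: "has_bochner_integral lborel (\<lambda>x. (c0 + c1 * x\<^sup>2) * exp (- x\<^sup>2 / (2 * v))) ((c0 + c1 * v) * sqrt (2 * pi * v))" .
  show ?thesis
    using h v c by (subst nn_integral_eq_integral) (auto simp: has_bochner_integral_iff)
qed

text \<open>The positive root \<open>u\<close> of \<open>u\<^sup>2 - s u - 1\<close>, that is, the inverse of \<open>u \<mapsto> u - 1/u\<close> on the positive half-line.\<close>
definition pos_root :: "real \<Rightarrow> real" where
  "pos_root s = (s + sqrt (s\<^sup>2 + 4)) / 2"

lemma pos_root_pos: "pos_root s > 0"
proof -
  have "\<bar>s\<bar> < sqrt (s\<^sup>2 + 4)" by (intro real_less_rsqrt) simp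
  thus ?thesis by (simp add: pos_root_def)
qed

lemma pos_root_minus: "pos_root (- s) = 1 / pos_root s"
proof -
  have "pos_root (- s) * pos_root s = ((sqrt (s\<^sup>2 + 4))\<^sup>2 - s\<^sup>2) / 4"
    unfolding pos_root_def by (simp add: power2_eq_square field_simps)
  also have "\<dots> = 1" by simp
  finally show ?thesis using pos_root_pos[of s] by (simp add: field_simps)
qed

lemma pos_root_unique: "u > 0 \<Longrightarrow> pos_root (u - 1 / u) = u"
proof -
  assume u: "u > 0"
  have "sqrt ((u - 1 / u)\<^sup>2 + 4) = u + 1 / u"
    using u by (intro real_sqrt_unique) (simp_all add: power2_eq_square field_simps)
  thus ?thesis by (simp add: pos_root_def)
qed

lemma pos_root_diff: "pos_root s - 1 / pos_root s = s"
  unfolding pos_root_minus[symmetric] by (simp add: pos_root_def field_simps)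

text \<open>
  Put \<open>s = \<surd>y - 1/\<surd>y\<close>, a bijection of the half-line onto the line with inverse \<open>y = u\<^sup>2\<close>, \<open>u\<close> being
  \<open>pos_root s\<close>. Then \<open>dy / (y \<surd>y) = (1 - s/r) ds\<close> with \<open>r = \<surd>(s\<^sup>2 + 4)\<close>. Averaging the resulting integrand over
  \<open>s\<close> and \<open>-s\<close> removes \<open>r\<close> and leaves a Gaussian times a polynomial: the even part of \<open>1 - s/r\<close> is 1, and
  that of \<open>(1 - s/r) / y\<close> is \<open>s\<^sup>2 + 1\<close>. The term \<open>c2 / y\<close> is needed for the mean of the first coordinate of \<open>J\<close>.
\<close>
lemma half_line_gaussian_integral:
  fixes a c0 c1 c2 :: real
  assumes a: "a > 0" and c: "c0 \<ge> 0" "c1 \<ge> 0" "c2 \<ge> 0"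
  shows "(\<integral>\<^sup>+y. indicator {0<..} y * ennreal ((c0 + c1 * (sqrt y - 1 / sqrt y)\<^sup>2 + c2 / y) * exp (- a * (sqrt y - 1 / sqrt y)\<^sup>2 / 2) / (y * sqrt y)) \<partial>lborel)
    = ennreal ((c0 + c2 + (c1 + c2) / a) * sqrt (2 * pi / a))" (is "_ = ennreal ?I")
proof -
  let ?r = "\<lambda>s::real. sqrt (s\<^sup>2 + 4)" and ?u = pos_root
  define E where "E s = exp (- s\<^sup>2 / (2 * (1 / a)))" for s
  define G where "G s = (1 - s / ?r s) * (c0 + c1 * s\<^sup>2 + c2 * (?u (- s))\<^sup>2) * E s" for s
  define F where "F y = (c0 + c1 * (sqrt y - 1 / sqrt y)\<^sup>2 + c2 / y) * exp (- a * (sqrt y - 1 / sqrt y)\<^sup>2 / 2) / (y * sqrt y)" for y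
  define g where "g s = (?u s)\<^sup>2" for s
  define g' where "g' s = 2 * (?u s)\<^sup>2 / ?r s" for s
  have r0: "?r s > 0" for s by (simp add: add_nonneg_pos)
  have I0: "?I \<ge> 0" using a c by simp
  have "\<bar>s\<bar> \<le> ?r s" for s by (rule real_le_rsqrt) simp
  hence "\<bar>s / ?r s\<bar> \<le> 1" for s using r0[of s] by (simp add: abs_divide)
  hence one: "1 - s / ?r s \<ge> 0" for s by (meson abs_le_D1 diff_ge_0_iff_ge)
  have G0: "G s \<ge> 0" for s using one c by (simp add: G_def E_def)
  have [measurable]: "G \<in> borel_measurable borel"
    unfolding G_def[abs_def] E_def pos_root_def by measurable
  have sym: "G s + G (- s) = 2 * (((c0 + c2) + (c1 + c2) * s\<^sup>2) * E s)" for s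
  proof -
    have gen: "r * ((1 - s / r) * X * e + (1 - - s / r) * Y * e) = ((r - s) * X + (r + s) * Y) * e"
      if "r > 0" for r X Y e :: real using that by (simp add: field_simps)
    have "?r s * (G s + G (- s)) = ((?r s - s) * (c0 + c1 * s\<^sup>2 + c2 * ((?r s - s) / 2)\<^sup>2) + (?r s + s) * (c0 + c1 * s\<^sup>2 + c2 * ((?r s + s) / 2)\<^sup>2)) * E s"
      using gen[OF r0[of s]] by (simp add: G_def E_def pos_root_def add.commute)
    also have "\<dots> = ?r s * ((2 * (c0 + c1 * s\<^sup>2) + c2 / 2 * ((?r s)\<^sup>2 + 3 * s\<^sup>2)) * E s)"
      by (simp add: algebra_simps power2_eq_square add_divide_distrib diff_divide_distrib)
    also have "(?r s)\<^sup>2 = s\<^sup>2 + 4" by simp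
    finally have "G s + G (- s) = (2 * (c0 + c1 * s\<^sup>2) + c2 / 2 * (s\<^sup>2 + 4 + 3 * s\<^sup>2)) * E s"
      using r0[of s] by simp
    also have "\<dots> = 2 * (((c0 + c2) + (c1 + c2) * s\<^sup>2) * E s)" by (simp add: algebra_simps)
    finally show ?thesis .
  qed
  have "2 * (\<integral>\<^sup>+s. ennreal (G s) \<partial>lborel) = (\<integral>\<^sup>+s. ennreal (G s) \<partial>lborel) + (\<integral>\<^sup>+s. ennreal (G (- s)) \<partial>lborel)"
    using nn_integral_real_affine[of "\<lambda>s. ennreal (G s)" "-1" 0] by (simp add: mult_2)
  also have "\<dots> = (\<integral>\<^sup>+s. ennreal (2 * (((c0 + c2) + (c1 + c2) * s\<^sup>2) * E s)) \<partial>lborel)"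
    unfolding sym[symmetric] using G0 by (subst nn_integral_add[symmetric]) (auto simp: ennreal_plus)
  also have "\<dots> = 2 * (\<integral>\<^sup>+s. ennreal (((c0 + c2) + (c1 + c2) * s\<^sup>2) * E s) \<partial>lborel)"
    using c by (subst nn_integral_cmult[symmetric]) (auto simp: ennreal_mult' E_def)
  also have "(\<integral>\<^sup>+s. ennreal (((c0 + c2) + (c1 + c2) * s\<^sup>2) * E s) \<partial>lborel) = ennreal ?I"
    unfolding E_def using a c by (subst gaussian_integral) simp_all
  finally have "(\<integral>\<^sup>+s. ennreal (G s) \<partial>lborel) = ennreal ?I"
    by (subst (asm) ennreal_mult_cancel_left) auto
  hence "(G has_integral ?I) UNIV" using G0 I0 by (intro nn_integral_has_integral) auto
  hence GI: "G absolutely_integrable_on UNIV" "integral UNIV G = ?I"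
    using absolutely_integrable_on_iff_nonneg[of UNIV G] G0 by (auto simp: integrable_on_def)
  have deriv: "(g has_field_derivative g' s) (at s)" for s
  proof -
    have "((\<lambda>s. (s + sqrt (s\<^sup>2 + 4)) / 2) has_field_derivative (1 + s / ?r s) / 2) (at s)"
      using r0[of s] by (auto intro!: derivative_eq_intros simp: field_simps)
    moreover have "(1 + s / ?r s) / 2 = ?u s / ?r s"
      using r0[of s] by (simp add: pos_root_def field_simps)
    ultimately have "(?u has_field_derivative ?u s / ?r s) (at s)"
      by (simp add: pos_root_def[abs_def])
    thus ?thesis unfolding g_def[abs_def] g'_def
      by (rule DERIV_power[THEN DERIV_cong]) (simp add: power2_eq_square)
  qed
  have sq: "sqrt (g s) = ?u s" for s using pos_root_pos[of s] by (simp add: g_def)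
  have "g s > 0" for s using pos_root_pos[of s] by (simp add: g_def)
  hence "range g \<subseteq> {0<..}" by auto
  have "inj g" by (rule injI) (metis sq pos_root_diff)
  have "range g = {0<..}"
  proof (intro equalityI subsetI)
    fix y :: real assume "y \<in> {0<..}"
    hence "g (sqrt y - 1 / sqrt y) = y" by (simp add: g_def pos_root_unique)
    thus "y \<in> range g" by (metis rangeI)
  qed (use \<open>range g \<subseteq> {0<..}\<close> in blast)
  have pull: "\<bar>g' s\<bar> * F (g s) = G s" for s
  proof -
    have u: "?u s > 0" by (rule pos_root_pos)
    have e: "exp (- a * (sqrt (g s) - 1 / sqrt (g s))\<^sup>2 / 2) = E s"
      using a unfolding sq pos_root_diff E_def by (simp add: mult.commute)
    have "1 - s / ?r s = 2 / ?r s * ?u (- s)"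
      using r0[of s] by (simp add: pos_root_def diff_divide_distrib)
    also have "\<dots> = 2 * (?u s)\<^sup>2 / ?r s / (g s * ?u s)"
      using u r0[of s] unfolding pos_root_minus g_def by (simp add: field_simps power2_eq_square)
    finally have j: "1 - s / ?r s = g' s / (g s * ?u s)" by (simp add: g'_def)
    have "c2 / g s = c2 * (?u (- s))\<^sup>2" by (simp add: pos_root_minus g_def power_divide)
    moreover have "\<bar>g' s\<bar> = g' s" using r0[of s] by (simp add: g'_def)
    ultimately show ?thesis unfolding F_def e G_def j by (simp add: sq pos_root_diff)
  qed
  have "F absolutely_integrable_on g ` UNIV \<and> integral (g ` UNIV) F = ?I"
    using GI by (intro has_absolute_integral_change_of_variables_1'[of UNIV g g', THEN iffD1])
     (use deriv \<open>inj g\<close> in \<open>auto simp: pull\<close>)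
  hence "F absolutely_integrable_on {0<..}" "integral {0<..} F = ?I"
    unfolding \<open>range g = {0<..}\<close> by blast+
  hence "(F has_integral ?I) {0<..}"
    unfolding has_integral_iff by (intro conjI set_lebesgue_integral_eq_integral(1))
  moreover have "F y \<ge> 0" if "y \<in> {0<..}" for y using that c by (simp add: F_def)
  ultimately show ?thesis
    using nn_integral_has_integral_lebesgue'[of "{0<..}" F ?I] by (simp add: F_def mult.commute)
qed

section \<open>Gibbs integrals in the rest frame\<close>

text \<open>The last coordinate of the moment map.\<close>
definition height :: "real \<Rightarrow> complex \<Rightarrow> real" where
  "height R \<xi> = R * (1 + (cmod \<xi>)\<^sup>2) / (2 * Im \<xi>)"

lemma height_borel [measurable]: "height R \<in> borel_measurable borel"
  unfolding height_def[abs_def] by measurable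

lemma height_split:
  assumes "y > 0"
  shows "height R (Complex x y) - R = R / 2 * (x\<^sup>2 / y + (sqrt y - 1 / sqrt y)\<^sup>2)"
proof -
  have "(sqrt y - 1 / sqrt y)\<^sup>2 = y - 2 + 1 / y"
    using assms by (simp add: power2_diff power_divide field_simps) (simp add: power2_eq_square)
  moreover have "(cmod (Complex x y))\<^sup>2 = x\<^sup>2 + y\<^sup>2" by (simp add: cmod_power2)
  ultimately show ?thesis using assms by (simp add: height_def field_simps power2_eq_square)
qed

lemma height_ge: 
  assumes "\<xi> \<in> half_plane" "R > 0" shows "height R \<xi> \<ge> R"
proof -
  have i: "Im \<xi> > 0" using assms by (simp add: half_plane_def)
  have "0 \<le> R / 2 * ((Re \<xi>)\<^sup>2 / Im \<xi> + (sqrt (Im \<xi>) - 1 / sqrt (Im \<xi>))\<^sup>2)"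
    using i assms by simp
  thus ?thesis using height_split[OF i, of R "Re \<xi>"] by simp
qed

text \<open>
  Fubini: for fixed \<open>y\<close> the integrand is, by \<open>height_split\<close>, a Gaussian in \<open>x\<close> of variance \<open>y / (k R)\<close>, and what
  remains is \<open>half_line_gaussian_integral\<close>. The three weights give the partition function, the mean
  height, and the mean of \<open>1 / Im \<xi>\<close>, which is the sum of the first and last coordinates of \<open>J\<close> over \<open>R\<close>.
\<close>
lemma hp_gibbs_integral:
  fixes R k q0 q1 q2 :: real
  assumes R: "R > 0" and k: "k > 0" and q: "q0 \<ge> 0" "q1 \<ge> 0" "q2 \<ge> 0"
  shows "(\<integral>\<^sup>+\<xi>. ennreal ((q0 + q1 * (height R \<xi> - R) + q2 / Im \<xi>) * exp (- k * (height R \<xi> - R))) \<partial>hp_measure R)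
    = ennreal (2 * pi / k * (q0 + q1 / k + q2 * (1 + 1 / (k * R))))"
proof -
  define a where "a = k * R"
  have a: "a > 0" using R k by (simp add: a_def)
  define F where "F y = (q0 + q1 * R / (2 * a) + q1 * R / 2 * (sqrt y - 1 / sqrt y)\<^sup>2 + q2 / y) * exp (- a * (sqrt y - 1 / sqrt y)\<^sup>2 / 2) / (y * sqrt y)" for y
  define c where "c = R * sqrt (2 * pi / a)"
  have c0: "c \<ge> 0" using R a by (simp add: c_def)
  have F0: "F y \<ge> 0" if "y > 0" for y using that q R a by (simp add: F_def)
  have inner: "ennreal (R / y\<^sup>2) * (\<integral>\<^sup>+x. ennreal ((q0 + q1 * (height R (Complex x y) - R) + q2 / y) * exp (- k * (height R (Complex x y) - R))) \<partial>lborel)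
     = ennreal (c * F y)" if y: "y > 0" for y
  proof -
    let ?s = "sqrt y - 1 / sqrt y" and ?v = "y / a"
    let ?e = "exp (- a * ?s\<^sup>2 / 2)"
    have v: "?v > 0" using y a by simp
    have "(q0 + q1 * (height R (Complex x y) - R) + q2 / y) * exp (- k * (height R (Complex x y) - R))
      = ((q0 + q1 * R / 2 * ?s\<^sup>2 + q2 / y) * ?e + q1 * R / (2 * y) * ?e * x\<^sup>2) * exp (- x\<^sup>2 / (2 * ?v))" for x
    proof -
      have "exp (- k * (height R (Complex x y) - R)) = ?e * exp (- x\<^sup>2 / (2 * ?v))"
        unfolding height_split[OF y] exp_add[symmetric] using y a by (simp add: a_def field_simps)
      thus ?thesis unfolding height_split[OF y] using y by (simp add: field_simps)
    qed
    hence "(\<integral>\<^sup>+x. ennreal ((q0 + q1 * (height R (Complex x y) - R) + q2 / y) * exp (- k * (height R (Complex x y) - R))) \<partial>lborel)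
      = ennreal (((q0 + q1 * R / 2 * ?s\<^sup>2 + q2 / y) * ?e + q1 * R / (2 * y) * ?e * ?v) * sqrt (2 * pi * ?v))"
      using q R y by (simp only:) (subst gaussian_integral[OF v], simp_all)
    moreover have "R / y\<^sup>2 * (((q0 + q1 * R / 2 * ?s\<^sup>2 + q2 / y) * ?e + q1 * R / (2 * y) * ?e * ?v) * sqrt (2 * pi * ?v)) = c * F y"
    proof -
      have "sqrt (2 * pi * ?v) = sqrt (2 * pi / a) * sqrt y" by (simp add: real_sqrt_mult real_sqrt_divide)
      moreover have "sqrt y / y\<^sup>2 = 1 / (y * sqrt y)" 
        using y by (simp add: field_simps power2_eq_square)
      moreover have "(q0 + q1 * R / 2 * ?s\<^sup>2 + q2 / y) * ?e + q1 * R / (2 * y) * ?e * ?v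
        = (q0 + q1 * R / (2 * a) + q1 * R / 2 * ?s\<^sup>2 + q2 / y) * ?e" using y a by (simp add: field_simps)
      moreover have "R / y\<^sup>2 * (X * (S * sqrt y)) = R * S * (X * (sqrt y / y\<^sup>2))" for X S by simp
      ultimately show ?thesis unfolding F_def c_def by simp
    qed
    ultimately show ?thesis using R y q a
      by (simp only:) (subst ennreal_mult[symmetric], auto)
  qed
  have "(\<integral>\<^sup>+\<xi>. ennreal ((q0 + q1 * (height R \<xi> - R) + q2 / Im \<xi>) * exp (- k * (height R \<xi> - R))) \<partial>hp_measure R)
    = (\<integral>\<^sup>+y. indicator {0<..} y * ennreal (c * F y) \<partial>lborel)"
  proof (subst nn_integral_hp, goal_cases)
    case 3
    show ?case
    proof (intro nn_integral_cong)
      fix y :: real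
      show "indicator {0<..} y * ennreal (R / y\<^sup>2) * (\<integral>\<^sup>+x. ennreal ((q0 + q1 * (height R (Complex x y) - R) + q2 / Im (Complex x y)) *
         exp (- k * (height R (Complex x y) - R))) \<partial>lborel) = indicator {0<..} y * ennreal (c * F y)"
        using inner[of y] by (cases "y > 0") (simp_all add: mult.assoc)
    qed
  qed (use R in simp_all)
  also have "\<dots> = (\<integral>\<^sup>+y. ennreal c * (indicator {0<..} y * ennreal (F y)) \<partial>lborel)"
    using F0 c0 by (intro nn_integral_cong) (auto simp: ennreal_mult split: split_indicator)
  also have "\<dots> = ennreal c * (\<integral>\<^sup>+y. indicator {0<..} y * ennreal (F y) \<partial>lborel)"
    unfolding F_def by (subst nn_integral_cmult) simp_all
  also have "(\<integral>\<^sup>+y. indicator {0<..} y * ennreal (F y) \<partial>lborel) 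
    = ennreal ((q0 + q1 * R / (2 * a) + q2 + (q1 * R / 2 + q2) / a) * sqrt (2 * pi / a))"
    unfolding F_def using R a q by (intro half_line_gaussian_integral) auto
  also have "ennreal c * \<dots> = ennreal (c * ((q0 + q1 * R / (2 * a) + q2 + (q1 * R / 2 + q2) / a) * sqrt (2 * pi / a)))"
    using c0 R a q by (subst ennreal_mult) auto
  also have "c * ((q0 + q1 * R / (2 * a) + q2 + (q1 * R / 2 + q2) / a) * sqrt (2 * pi / a))
     = 2 * pi / k * (q0 + q1 / k + q2 * (1 + 1 / (k * R)))"
  proof -
    have "c * ((q0 + q1 * R / (2 * a) + q2 + (q1 * R / 2 + q2) / a) * sqrt (2 * pi / a))
      = R * (sqrt (2 * pi / a))\<^sup>2 * (q0 + q1 * R / (2 * a) + q2 + (q1 * R / 2 + q2) / a)"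
    proof -
      have "R * w * (Y * w) = R * w\<^sup>2 * Y" for w Y :: real by (simp add: power2_eq_square)
      thus ?thesis unfolding c_def by blast
    qed
    also have "\<dots> = 2 * pi / k * (q0 + q1 / k + q2 * (1 + 1 / (k * R)))"
      using a R k by (simp add: a_def field_simps)
    finally show ?thesis .
  qed
  finally show ?thesis .
qed

lemma hp_gibbs_has_integral:
  fixes R k q0 q1 q2 :: real
  assumes R: "R > 0" and k: "k > 0" and q: "q0 \<ge> 0" "q1 \<ge> 0" "q2 \<ge> 0"
  shows "has_bochner_integral (hp_measure R) (\<lambda>\<xi>. (q0 + q1 * (height R \<xi> - R) + q2 / Im \<xi>) * exp (- k * (height R \<xi> - R)))
    (2 * pi / k * (q0 + q1 / k + q2 * (1 + 1 / (k * R))))"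
proof (rule has_bochner_integral_nn_integral)
  show "AE \<xi> in hp_measure R. 0 \<le> (q0 + q1 * (height R \<xi> - R) + q2 / Im \<xi>) * exp (- k * (height R \<xi> - R))"
  proof (intro AE_I2)
    fix \<xi> assume "\<xi> \<in> space (hp_measure R)"
    hence "\<xi> \<in> half_plane" by simp
    hence "height R \<xi> - R \<ge> 0" "Im \<xi> > 0" using height_ge[of \<xi> R] R by (auto simp: half_plane_def)
    thus "0 \<le> (q0 + q1 * (height R \<xi> - R) + q2 / Im \<xi>) * exp (- k * (height R \<xi> - R))"
      using q by simp
  qed
qed (use hp_gibbs_integral[OF assms] assms in \<open>auto intro!: measurable_hp\<close>)

text \<open>The Gibbs density for the temperature \<open>-k e\<^sub>z\<close>.\<close>
definition rest_density :: "real \<Rightarrow> real \<Rightarrow> complex \<Rightarrow> real" where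
  "rest_density R k \<xi> = k / (2 * pi) * exp (- k * (height R \<xi> - R))"

lemma rest_moment:
  assumes R: "R > 0" and k: "k > 0" and q: "q0 \<ge> 0" "q1 \<ge> 0" "q2 \<ge> 0"
  shows "has_bochner_integral (hp_measure R) (\<lambda>\<xi>. rest_density R k \<xi> * (q0 + q1 * (height R \<xi> - R) + q2 / Im \<xi>))
     (q0 + q1 / k + q2 * (1 + 1 / (k * R)))"
proof -
  have v: "k / (2 * pi) * (2 * pi / k * V) = V" for V using k by simp
  have f: "rest_density R k \<xi> * (q0 + q1 * (height R \<xi> - R) + q2 / Im \<xi>)
    = k / (2 * pi) * ((q0 + q1 * (height R \<xi> - R) + q2 / Im \<xi>) * exp (- k * (height R \<xi> - R)))" for \<xi>
    by (simp add: rest_density_def)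
  from has_bochner_integral_mult_right[OF hp_gibbs_has_integral[OF assms], of "k / (2 * pi)"]
  show ?thesis unfolding v f by assumption
qed

lemma rest_density_nonneg: "k > 0 \<Longrightarrow> rest_density R k \<xi> \<ge> 0"
  by (simp add: rest_density_def)

text \<open>
  The factors of the density are \<open>1\<close> and the coordinates \<open>z\<close>, \<open>x\<close>, \<open>y\<close> of \<open>J\<close>. The mean of \<open>x\<close> vanishes because
  \<open>x + z = R / Im \<xi>\<close> has the same mean as \<open>z\<close>, and the mean of \<open>y\<close> by the symmetry \<open>Re \<xi> \<mapsto> - Re \<xi>\<close>.
\<close>
lemma rest_expectations:
  assumes R: "R > 0" and k: "k > 0"
  shows "has_bochner_integral (hp_measure R) (rest_density R k) 1"
    "has_bochner_integral (hp_measure R) (\<lambda>\<xi>. rest_density R k \<xi> * height R \<xi>) (R + 1 / k)"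
    "has_bochner_integral (hp_measure R) (\<lambda>\<xi>. rest_density R k \<xi> * (R / Im \<xi> - height R \<xi>)) 0"
    "has_bochner_integral (hp_measure R) (\<lambda>\<xi>. rest_density R k \<xi> * (R * Re \<xi> / Im \<xi>)) 0"
proof -
  let ?M = "hp_measure R" and ?\<rho> = "rest_density R k"
  show 0: "has_bochner_integral ?M ?\<rho> 1" using rest_moment[OF R k, of 1 0 0] by simp
  show 1: "has_bochner_integral ?M (\<lambda>\<xi>. ?\<rho> \<xi> * height R \<xi>) (R + 1 / k)"
    using rest_moment[OF R k, of R 1 0] R by simp
  have 2: "has_bochner_integral ?M (\<lambda>\<xi>. ?\<rho> \<xi> * (R / Im \<xi>)) (R + 1 / k)"
  proof -
    have "R * (1 + 1 / (k * R)) = R + 1 / k" using R k by (simp add: field_simps)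
    thus ?thesis using rest_moment[OF R k, of 0 0 R] R by simp
  qed
  show "has_bochner_integral ?M (\<lambda>\<xi>. ?\<rho> \<xi> * (R / Im \<xi> - height R \<xi>)) 0"
    using has_bochner_integral_diff[OF 2 1] by (simp add: algebra_simps)
  have int: "integrable ?M (\<lambda>\<xi>. ?\<rho> \<xi> * (R * Re \<xi> / Im \<xi>))"
  proof (rule Bochner_Integration.integrable_bound)
    show "integrable ?M (\<lambda>\<xi>. ?\<rho> \<xi> * height R \<xi>)" using 1 by (simp add: has_bochner_integral_iff)
    show "(\<lambda>\<xi>. ?\<rho> \<xi> * (R * Re \<xi> / Im \<xi>)) \<in> borel_measurable ?M"
      unfolding rest_density_def by (intro measurable_hp) measurable
    show "AE \<xi> in ?M. norm (?\<rho> \<xi> * (R * Re \<xi> / Im \<xi>)) \<le> norm (?\<rho> \<xi> * height R \<xi>)"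
    proof (intro AE_I2)
      fix \<xi> assume "\<xi> \<in> space ?M"
      hence "\<xi> \<in> half_plane" by simp
      hence i: "Im \<xi> > 0" and h: "height R \<xi> \<ge> 0" using height_ge[of \<xi> R] R by (auto simp: half_plane_def)
      have "2 * \<bar>Re \<xi>\<bar> \<le> 1 + (Re \<xi>)\<^sup>2" using zero_le_power2[of "\<bar>Re \<xi>\<bar> - 1"] by (simp add: power2_diff)
      also have "\<dots> \<le> 1 + (cmod \<xi>)\<^sup>2" by (simp add: cmod_power2)
      finally have "R * (2 * \<bar>Re \<xi>\<bar>) \<le> R * (1 + (cmod \<xi>)\<^sup>2)" using R by simp
      hence "\<bar>R * Re \<xi> / Im \<xi>\<bar> \<le> height R \<xi>" using i R by (simp add: height_def abs_mult field_simps)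
      thus "norm (?\<rho> \<xi> * (R * Re \<xi> / Im \<xi>)) \<le> norm (?\<rho> \<xi> * height R \<xi>)"
        using h rest_density_nonneg[OF k, of R \<xi>] unfolding real_norm_def abs_mult[of "?\<rho> \<xi>"]
        by (intro mult_left_mono) auto
    qed
  qed
  let ?T = "\<lambda>\<xi>. Complex (0 + (-1) * Re \<xi>) (1 * Im \<xi>)"
  have T: "distr ?M ?M ?T = ?M" using hp_invariant[OF R, of 1 "-1" 0] by simp
  have TM: "?T \<in> measurable ?M ?M" by (rule hp_affine_measurable) simp
  have "(\<integral>\<xi>. ?\<rho> \<xi> * (R * Re \<xi> / Im \<xi>) \<partial>?M) = (\<integral>\<xi>. ?\<rho> \<xi> * (R * Re \<xi> / Im \<xi>) \<partial>distr ?M ?M ?T)" by (simp only: T)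
  also have "\<dots> = (\<integral>\<xi>. ?\<rho> (?T \<xi>) * (R * Re (?T \<xi>) / Im (?T \<xi>)) \<partial>?M)"
    using int by (intro integral_distr TM) auto
  also have "\<dots> = - (\<integral>\<xi>. ?\<rho> \<xi> * (R * Re \<xi> / Im \<xi>) \<partial>?M)"
    by (subst Bochner_Integration.integral_minus[symmetric]) (simp add: rest_density_def height_def cmod_power2)
  finally show "has_bochner_integral ?M (\<lambda>\<xi>. ?\<rho> \<xi> * (R * Re \<xi> / Im \<xi>)) 0"
    using int by (simp add: has_bochner_integral_iff)
qed

section \<open>The orbit as a half-plane\<close>

locale half_plane_frame = lorentz_frame B e for B :: "'f::euclidean_space \<Rightarrow> 'f \<Rightarrow> real" and e +
  fixes R :: real and Or :: "(3 \<Rightarrow> 'f) set" and Fut :: "'f set"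
  assumes Rpos: "R > 0" and orientation: "is_orientation Or"
    and component: "Fut \<in> components (causal_vectors B)"
    and admissible: "admissible_basis B Or Fut e"
begin

lemma e_Or: "e \<in> Or" and e3_Fut: "e 3 \<in> Fut"
  using admissible by (auto simp: admissible_basis_def)

abbreviation J :: "complex \<Rightarrow> 'f" where "J \<equiv> J_half_plane R B e"

definition moment_vec :: "complex \<Rightarrow> 'f" where
  "moment_vec \<xi> = fvec (R * (1 - (cmod \<xi>)\<^sup>2) / (2 * Im \<xi>)) (R * Re \<xi> / Im \<xi>) (height R \<xi>)"

lemma orbit_iff: "v \<in> orbit_P R e \<longleftrightarrow> cz v = sqrt (R\<^sup>2 + (cx v)\<^sup>2 + (cy v)\<^sup>2)"
proof
  assume "cz v = sqrt (R\<^sup>2 + (cx v)\<^sup>2 + (cy v)\<^sup>2)"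
  hence "v = cx v *\<^sub>R e 1 + cy v *\<^sub>R e 2 + sqrt (R\<^sup>2 + (cx v)\<^sup>2 + (cy v)\<^sup>2) *\<^sub>R e 3"
    by (simp add: vec_eq)
  thus "v \<in> orbit_P R e" unfolding orbit_P_def by blast
qed (auto simp: orbit_P_def)

text \<open>
  With \<open>w = (x + i y) / (R + z)\<close> one has \<open>U_M w = i (R + z - x - i y) / (R + z + x + i y)\<close>; the relation
  \<open>z\<^sup>2 = R\<^sup>2 + x\<^sup>2 + y\<^sup>2\<close> reduces this fraction to \<open>(y + i R) / (x + z)\<close>.
\<close>
lemma chart_eq:
  assumes "v \<in> orbit_P R e"
  shows "cx v + cz v > 0" "U_M (psi R B e v) = Complex (cy v / (cx v + cz v)) (R / (cx v + cz v))"
proof -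
  define x y z where d: "x = cx v" "y = cy v" "z = cz v"
  have z: "z = sqrt (R\<^sup>2 + x\<^sup>2 + y\<^sup>2)" using assms by (simp add: orbit_iff d)
  have z2: "z * z = R * R + x * x + y * y" unfolding z by (simp flip: power2_eq_square)
  have "\<bar>x\<bar> < z" unfolding z using Rpos by (intro real_less_rsqrt) (simp add: add_pos_nonneg)
  hence xz: "x + z > 0" and z0: "z > 0" by linarith+
  thus "cx v + cz v > 0" by (simp add: d)
  define w where "w = Complex x y / of_real (R + z)"
  have psi: "psi R B e v = w"
    by (simp add: psi_def w_def Let_def lcoords_coord z flip: d)
  have Rz: "R + z > 0" using z0 Rpos by simp
  have "1 + w = Complex (R + z + x) y / of_real (R + z)" "1 - w = Complex (R + z - x) (- y) / of_real (R + z)"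
    using Rz by (simp_all add: w_def complex_eq_iff field_simps)
  moreover have ne: "Complex (R + z + x) y \<noteq> 0" using xz Rpos by (auto simp: complex_eq_iff)
  moreover have "(of_real (R + z) :: complex) \<noteq> 0" using Rz by (simp only: of_real_eq_0_iff)
  ultimately have "U_M w = \<i> * Complex (R + z - x) (- y) / Complex (R + z + x) y"
    by (simp add: U_M_def)
  also have "\<dots> = Complex (y / (x + z)) (R / (x + z))"
  proof -
    have "Complex y R * Complex (R + z + x) y = of_real (x + z) * (\<i> * Complex (R + z - x) (- y))"
      using z2 by (simp add: complex_eq_iff algebra_simps)
    moreover have "Complex (y / (x + z)) (R / (x + z)) = Complex y R / of_real (x + z)"
      using xz by (simp add: complex_eq_iff)
    moreover have "(of_real (x + z) :: complex) \<noteq> 0" using xz by (simp only: of_real_eq_0_iff)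
    ultimately show ?thesis using ne
      by (simp only:) (subst frac_eq_eq, simp_all only: mult.commute not_False_eq_True)
  qed
  finally show "U_M (psi R B e v) = Complex (cy v / (cx v + cz v)) (R / (cx v + cz v))"
    by (simp add: psi d)
qed

lemma height_pos: "\<xi> \<in> half_plane \<Longrightarrow> height R \<xi> > 0"
  using height_ge[of \<xi> R] Rpos by simp

lemma moment_vec_sum: "\<xi> \<in> half_plane \<Longrightarrow> cx (moment_vec \<xi>) + cz (moment_vec \<xi>) = R / Im \<xi>"
  by (simp add: moment_vec_def height_def half_plane_def field_simps)

lemma moment_vec_diff: "\<xi> \<in> half_plane \<Longrightarrow> cz (moment_vec \<xi>) - cx (moment_vec \<xi>) = R * (cmod \<xi>)\<^sup>2 / Im \<xi>"
  by (simp add: moment_vec_def height_def half_plane_def field_simps)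

lemma moment_vec_orbit: 
  assumes "\<xi> \<in> half_plane" shows "moment_vec \<xi> \<in> orbit_P R e"
proof -
  have i: "Im \<xi> > 0" using assms by (simp add: half_plane_def)
  have "(cz (moment_vec \<xi>))\<^sup>2 = R\<^sup>2 + (cx (moment_vec \<xi>))\<^sup>2 + (cy (moment_vec \<xi>))\<^sup>2"
  proof -
    have "(cz (moment_vec \<xi>))\<^sup>2 - (cx (moment_vec \<xi>))\<^sup>2 = (R * (cmod \<xi>)\<^sup>2 / Im \<xi>) * (R / Im \<xi>)"
      unfolding moment_vec_sum[OF assms, symmetric] moment_vec_diff[OF assms, symmetric] by (simp add: power2_eq_square algebra_simps)
    also have "\<dots> = R\<^sup>2 + (R * Re \<xi> / Im \<xi>)\<^sup>2"
      unfolding cmod_power2 using i by (simp add: field_simps power2_eq_square)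
    finally show ?thesis by (simp add: moment_vec_def)
  qed
  moreover have "cz (moment_vec \<xi>) > 0" using height_pos[OF assms] by (simp add: moment_vec_def)
  ultimately show ?thesis unfolding orbit_iff by (simp add: real_sqrt_unique)
qed

lemma chart_moment_vec:
  assumes "\<xi> \<in> half_plane" shows "(U_M \<circ> psi R B e) (moment_vec \<xi>) = \<xi>"
  using chart_eq(2)[OF moment_vec_orbit[OF assms]] assms Rpos
  by (simp add: moment_vec_sum complex_eq_iff half_plane_def) (simp add: moment_vec_def)

lemma chart_half_plane: "v \<in> orbit_P R e \<Longrightarrow> (U_M \<circ> psi R B e) v \<in> half_plane"
  using chart_eq Rpos by (simp add: half_plane_def)

lemma moment_vec_chart:
  assumes "v \<in> orbit_P R e" shows "moment_vec ((U_M \<circ> psi R B e) v) = v"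
proof -
  let ?\<xi> = "(U_M \<circ> psi R B e) v"
  note c = chart_eq[OF assms] 
  note h = chart_half_plane[OF assms]
  have z2: "cz v * cz v = R * R + cx v * cx v + cy v * cy v"
    using assms unfolding orbit_iff by (metis add_nonneg_nonneg power2_eq_square real_sqrt_pow2 zero_le_power2)
  have "cy (moment_vec ?\<xi>) = cy v" using c Rpos by (simp add: moment_vec_def)
  moreover have "cz (moment_vec ?\<xi>) + cx (moment_vec ?\<xi>) = cz v + cx v" using moment_vec_sum[OF h] c Rpos by simp
  moreover have "cz (moment_vec ?\<xi>) - cx (moment_vec ?\<xi>) = cz v - cx v" 
    unfolding moment_vec_diff[OF h] using c Rpos z2 
    by (simp add: cmod_power2 divide_simps) (simp add: power2_eq_square algebra_simps)
  ultimately show ?thesis by (simp add: vec_eq_null)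
qed

lemma chart_bij: "bij_betw (U_M \<circ> psi R B e) (orbit_P R e) half_plane"
  by (rule bij_betw_byWitness[where f' = moment_vec])
     (use chart_moment_vec moment_vec_chart chart_half_plane moment_vec_orbit in auto)

lemma J_eq_moment_vec: "\<xi> \<in> half_plane \<Longrightarrow> J \<xi> = moment_vec \<xi>"
  unfolding J_half_plane_def
  using chart_bij by (intro inv_into_f_eq) (auto simp: bij_betw_def moment_vec_orbit chart_moment_vec simp del: o_apply)

lemma J_formula:
  assumes "\<xi> \<in> half_plane"
  shows "J \<xi> = (R / (2 * Im \<xi>)) *\<^sub>R
        ((1 - (cmod \<xi>)\<^sup>2) *\<^sub>R e 1 + (2 * Re \<xi>) *\<^sub>R e 2 + (1 + (cmod \<xi>)\<^sup>2) *\<^sub>R e 3)"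
  using assms by (simp add: J_eq_moment_vec vec_eq moment_vec_def height_def half_plane_def)

lemma moebius_half_plane:
  assumes "A \<in> SL2" "\<xi> \<in> half_plane"
  shows "Im (moebius_act A \<xi>) = Im \<xi> / (cmod (of_real (A$2$1) * \<xi> + of_real (A$2$2)))\<^sup>2"
    "of_real (A$2$1) * \<xi> + of_real (A$2$2) \<noteq> 0"
    "moebius_act A \<xi> \<in> half_plane"
proof -
  let ?d = "of_real (A$2$1) * \<xi> + of_real (A$2$2) :: complex"
  have i: "Im \<xi> > 0" using assms(2) by (simp add: half_plane_def)
  have det: "A$1$1 * A$2$2 - A$1$2 * A$2$1 = 1" using assms(1) by (simp add: SL2_iff)
  show d: "?d \<noteq> 0"
  proof
    assume "?d = 0"
    hence "A$2$1 * Im \<xi> = 0" "A$2$1 * Re \<xi> + A$2$2 = 0" by (simp_all add: complex_eq_iff)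
    with i det show False by simp
  qed
  have "Im (moebius_act A \<xi>) = (A$1$1 * A$2$2 - A$1$2 * A$2$1) * Im \<xi> / (cmod ?d)\<^sup>2"
    unfolding moebius_act_def Im_divide cmod_power2 by (simp add: algebra_simps)
  thus 1: "Im (moebius_act A \<xi>) = Im \<xi> / (cmod ?d)\<^sup>2" by (simp add: det)
  show "moebius_act A \<xi> \<in> half_plane" using i d by (simp add: half_plane_def 1)
qed

lemma J_equivariant:
  assumes "A \<in> SL2" "\<xi> \<in> half_plane"
  shows "J (moebius_act A \<xi>) = act A (J \<xi>)"
proof -
  obtain p q r s where A: "A$1$1 = p" "A$1$2 = q" "A$2$1 = r" "A$2$2 = s" by blast
  have det: "p * s - q * r = 1" using assms(1) A by (simp add: SL2_iff)
  let ?n = "of_real p * \<xi> + of_real q :: complex" and ?d = "of_real r * \<xi> + of_real s :: complex"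
  note h = moebius_half_plane[OF assms, unfolded A]
  have i: "Im \<xi> > 0" using assms(2) by (simp add: half_plane_def)
  have cd: "cmod ?d > 0" using h(2) by simp
  have null: "cz (moment_vec \<xi>) + cx (moment_vec \<xi>) = R / Im \<xi>" "cz (moment_vec \<xi>) - cx (moment_vec \<xi>) = R * (cmod \<xi>)\<^sup>2 / Im \<xi>"
    "cy (moment_vec \<xi>) = R * Re \<xi> / Im \<xi>"
    using moment_vec_sum[OF assms(2)] moment_vec_diff[OF assms(2)] by (simp_all add: moment_vec_def)
  have m: "moebius_act A \<xi> = ?n / ?d" by (simp add: moebius_act_def A)
  have "Re (?n * cnj ?d) = p * r * (cmod \<xi>)\<^sup>2 + (p * s + q * r) * Re \<xi> + q * s"
    unfolding cmod_power2 by (simp add: power2_eq_square algebra_simps)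
  hence re: "Re (?n / ?d) = (p * r * (cmod \<xi>)\<^sup>2 + (p * s + q * r) * Re \<xi> + q * s) / (cmod ?d)\<^sup>2"
    by (metis Re_divide_of_real complex_div_cnj of_real_power)
  have cm: "(cmod ?n)\<^sup>2 = p\<^sup>2 * (cmod \<xi>)\<^sup>2 + 2 * p * q * Re \<xi> + q\<^sup>2"
     "(cmod ?d)\<^sup>2 = r\<^sup>2 * (cmod \<xi>)\<^sup>2 + 2 * r * s * Re \<xi> + s\<^sup>2"
    by (simp_all add: cmod_power2) (simp_all add: power2_eq_square algebra_simps)
  have "moment_vec (moebius_act A \<xi>) = act A (moment_vec \<xi>)"
    unfolding vec_eq_null act_null A null
  proof (intro conjI)
    show "cz (moment_vec (moebius_act A \<xi>)) - cx (moment_vec (moebius_act A \<xi>)) =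
      p\<^sup>2 * (R * (cmod \<xi>)\<^sup>2 / Im \<xi>) + 2 * p * q * (R * Re \<xi> / Im \<xi>) + q\<^sup>2 * (R / Im \<xi>)"
      unfolding moment_vec_diff[OF h(3)] h(1) unfolding m norm_divide power_divide cm(1)
      using i cd by (simp add: field_simps)
    show "cy (moment_vec (moebius_act A \<xi>)) = p * r * (R * (cmod \<xi>)\<^sup>2 / Im \<xi>) +
        (p * s + q * r) * (R * Re \<xi> / Im \<xi>) + q * s * (R / Im \<xi>)"
      unfolding moment_vec_def coord_fvec h(1) unfolding m re using i cd by (simp add: field_simps)
    show "cz (moment_vec (moebius_act A \<xi>)) + cx (moment_vec (moebius_act A \<xi>)) =
      r\<^sup>2 * (R * (cmod \<xi>)\<^sup>2 / Im \<xi>) + 2 * r * s * (R * Re \<xi> / Im \<xi>) + s\<^sup>2 * (R / Im \<xi>)"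
      using moment_vec_sum[OF h(3)] unfolding h(1) unfolding cm(2) using i by (simp add: field_simps)
  qed
  thus ?thesis using h(3) assms(2) by (simp add: J_eq_moment_vec)
qed

text \<open>The values of \<open>J\<close> at \<open>i\<close>, \<open>2 i\<close> and \<open>1 + i\<close> form a basis.\<close>
lemma J_determines_linear:
  assumes "linear g" "linear h" "\<And>\<xi>. \<xi> \<in> half_plane \<Longrightarrow> g (J \<xi>) = h (J \<xi>)"
  shows "g = h"
proof -
  interpret d: linear "\<lambda>v. g v - h v" using assms(1,2) by (rule linear_compose_sub)
  have 0: "g (J \<xi>) - h (J \<xi>) = 0" if "\<xi> \<in> half_plane" for \<xi> using assms(3)[OF that] by simp
  have J: "J \<i> = R *\<^sub>R e 3" "J (2 * \<i>) = R *\<^sub>R ((5/4) *\<^sub>R e 3 - (3/4) *\<^sub>R e 1)" 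
     "J (1 + \<i>) = R *\<^sub>R ((3/2) *\<^sub>R e 3 + e 2 - (1/2) *\<^sub>R e 1)"
    by (simp_all add: J_formula half_plane_def vec_eq cmod_power2 norm_mult)
  have 3: "g (e 3) - h (e 3) = 0" using 0[of \<i>] Rpos by (simp add: J half_plane_def d.scale)
  have 1: "g (e 1) - h (e 1) = 0" using 0[of "2 * \<i>"] Rpos 3 by (simp add: J half_plane_def d.scale d.diff)
  have 2: "g (e 2) - h (e 2) = 0" using 0[of "1 + \<i>"] Rpos 3 1 by (simp add: J half_plane_def d.scale d.diff d.add)
  have "g v - h v = 0" for v
    by (subst (1 2) fvec_coord[symmetric]) (simp add: fvec_def d.add d.scale 1 2 3)
  thus ?thesis by (auto simp: fun_eq_iff)
qed

lemma SL2_hom_eq: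
  assumes "A \<in> SL2" shows "SL2_hom R B Or Fut e A = act A"
  unfolding SL2_hom_def
proof (rule the_equality)
  show "act A \<in> lorentz_group B Or Fut \<and> (\<forall>\<xi>\<in>half_plane. act A (J \<xi>) = J (moebius_act A \<xi>))"
    using act_lorentz_group[OF assms orientation e_Or component e3_Fut] J_equivariant[OF assms] by simp
  show "g = act A" if "g \<in> lorentz_group B Or Fut \<and> (\<forall>\<xi>\<in>half_plane. g (J \<xi>) = J (moebius_act A \<xi>))" for g
    using that J_equivariant[OF assms] by (intro J_determines_linear linear_act) (auto simp: lorentz_group_def)
qed

end

section \<open>Curves in SL(2)\<close>

definition mat2 :: "real \<Rightarrow> real \<Rightarrow> real \<Rightarrow> real \<Rightarrow> real^2^2" where
  "mat2 p q r s = vector [vector [p, q], vector [r, s]]"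

lemma mat2_entries [simp]:
  "mat2 p q r s $ 1 $ 1 = p" "mat2 p q r s $ 1 $ 2 = q" "mat2 p q r s $ 2 $ 1 = r" "mat2 p q r s $ 2 $ 2 = s"
  by (simp_all add: mat2_def)

lemma mat2_eq_iff: "A = B \<longleftrightarrow> A$1$1 = B$1$1 \<and> A$1$2 = B$1$2 \<and> A$2$1 = B$2$1 \<and> A$2$2 = (B$2$2::real)"
  for A B :: "real^2^2"
  by (auto simp: vec_eq_iff forall_2)

lemma sl2_iff: "X \<in> sl2 \<longleftrightarrow> X$2$2 = - X$1$1"
  by (auto simp: sl2_def trace_def sum_2)

lemma mat2_has_vector_derivative:
  assumes "(p has_real_derivative p') (at t)" "(q has_real_derivative q') (at t)"
    "(r has_real_derivative r') (at t)" "(s has_real_derivative s') (at t)"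
  shows "((\<lambda>t. mat2 (p t) (q t) (r t) (s t)) has_vector_derivative mat2 p' q' r' s') (at t)"
proof -
  have eq: "mat2 p q r s = p *\<^sub>R mat2 1 0 0 0 + q *\<^sub>R mat2 0 1 0 0 + r *\<^sub>R mat2 0 0 1 0 + s *\<^sub>R mat2 0 0 0 1"
    for p q r s by (simp add: mat2_eq_iff)
  show ?thesis
    unfolding eq[of "p _"] eq[of p'] using assms
    by (auto intro!: has_vector_derivative_add has_vector_derivative_scaleR[THEN has_vector_derivative_eq_rhs] derivative_eq_intros)
qed

text \<open>
  The curve is the product of an upper unipotent, a lower unipotent and a diagonal matrix, so that no
  matrix exponential is involved. Its existence makes the velocities and generators defined by
  a quantification over all curves unique.
\<close>
lemma SL2_curve_exists:
  assumes "X \<in> sl2" shows "\<exists>\<gamma>. SL2_curve X \<gamma>"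
proof -
  obtain p q r where X: "X$1$1 = p" "X$1$2 = q" "X$2$1 = r" by blast
  let ?\<gamma> = "\<lambda>t. mat2 ((1 + t\<^sup>2 * q * r) * exp (t * p)) (t * q * exp (- t * p)) (t * r * exp (t * p)) (exp (- t * p))"
  have "?\<gamma> t \<in> SL2" for t
    by (simp add: SL2_iff algebra_simps power2_eq_square exp_minus_inverse flip: exp_add)
  moreover have "?\<gamma> 0 = mat 1" by (simp add: mat2_eq_iff mat_def)
  moreover have "(?\<gamma> has_vector_derivative mat2 p q r (- p)) (at 0)"
    by (rule mat2_has_vector_derivative) (auto intro!: derivative_eq_intros)
  moreover have "mat2 p q r (- p) = X" using assms X by (simp add: mat2_eq_iff sl2_iff)
  ultimately show ?thesis unfolding SL2_curve_def by (intro exI[of _ ?\<gamma>]) simp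
qed

lemma SL2_curve_entry:
  assumes "SL2_curve X \<gamma>" shows "((\<lambda>t. \<gamma> t $ i $ j) has_real_derivative X $ i $ j) (at 0)"
proof -
  have "((\<lambda>t. \<gamma> t $ i $ j) has_vector_derivative X $ i $ j) (at 0)"
    using assms by (intro bounded_linear.has_vector_derivative[OF bounded_linear_vec_nth]) (simp add: SL2_curve_def)
  thus ?thesis by (simp add: has_real_derivative_iff_has_vector_derivative)
qed

lemma SL2_curve_0:
  assumes "SL2_curve X \<gamma>" 
  shows "\<gamma> 0 $ 1 $ 1 = 1" "\<gamma> 0 $ 1 $ 2 = 0" "\<gamma> 0 $ 2 $ 1 = 0" "\<gamma> 0 $ 2 $ 2 = 1"
  using assms by (simp_all add: SL2_curve_def mat_def)

lemma moebius_curve_derivative: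
  assumes "SL2_curve X \<gamma>"
  shows "((\<lambda>t. moebius_act (\<gamma> t) \<xi>) has_vector_derivative
    of_real (X$1$2) + of_real (X$1$1 - X$2$2) * \<xi> - of_real (X$2$1) * \<xi>\<^sup>2) (at 0)"
proof -
  note d = SL2_curve_entry[OF assms, unfolded has_field_derivative_def, THEN has_derivative_of_real]
  have "((\<lambda>t. moebius_act (\<gamma> t) \<xi>) has_derivative
    (\<lambda>h. ((of_real (X$1$1 * h) * \<xi> + of_real (X$1$2 * h)) * (of_real (\<gamma> 0$2$1) * \<xi> + of_real (\<gamma> 0$2$2))
       - (of_real (\<gamma> 0$1$1) * \<xi> + of_real (\<gamma> 0$1$2)) * (of_real (X$2$1 * h) * \<xi> + of_real (X$2$2 * h)))
      / ((of_real (\<gamma> 0$2$1) * \<xi> + of_real (\<gamma> 0$2$2)) * (of_real (\<gamma> 0$2$1) * \<xi> + of_real (\<gamma> 0$2$2))))) (at 0)"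
    unfolding moebius_act_def
    by (intro has_derivative_divide' has_derivative_add has_derivative_mult_left d) (simp add: SL2_curve_0[OF assms])
  thus ?thesis unfolding has_vector_derivative_def SL2_curve_0[OF assms]
    by (rule has_derivative_eq_rhs) (auto simp: scaleR_conv_of_real algebra_simps power2_eq_square)
qed

lemma fundamental_field_eq:
  assumes "X \<in> sl2"
  shows "fundamental_field X \<xi> = of_real (X$1$2) + 2 * of_real (X$1$1) * \<xi> - of_real (X$2$1) * \<xi>\<^sup>2"
  unfolding fundamental_field_def
proof (rule the_equality)
  let ?F = "of_real (X$1$2) + 2 * of_real (X$1$1) * \<xi> - of_real (X$2$1) * \<xi>\<^sup>2"
  have F: "of_real (X$1$2) + of_real (X$1$1 - X$2$2) * \<xi> - of_real (X$2$1) * \<xi>\<^sup>2 = ?F"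
    using assms by (simp add: sl2_iff)
  show all: "\<forall>\<gamma>. SL2_curve X \<gamma> \<longrightarrow> ((\<lambda>t. moebius_act (\<gamma> t) \<xi>) has_vector_derivative ?F) (at 0)"
    using moebius_curve_derivative[of X _ \<xi>] unfolding F by blast
  obtain \<gamma> where "SL2_curve X \<gamma>" using SL2_curve_exists[OF assms] by blast
  thus "u = ?F" if "\<forall>\<gamma>. SL2_curve X \<gamma> \<longrightarrow> ((\<lambda>t. moebius_act (\<gamma> t) \<xi>) has_vector_derivative u) (at 0)" for u
    using that all by (intro vector_derivative_unique_at) blast+
qed

section \<open>The identification of sl(2) with Lorentz vectors and the moment map\<close>

context half_plane_frame
begin

definition sl2_vec :: "real^2^2 \<Rightarrow> 'f" where
  "sl2_vec X = fvec (- (X$1$2 + X$2$1)) (- 2 * X$1$1) (X$1$2 - X$2$1)"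

lemma fvec_has_vector_derivative:
  assumes "(f has_real_derivative f') (at t)" "(g has_real_derivative g') (at t)"
    "(h has_real_derivative h') (at t)"
  shows "((\<lambda>t. fvec (f t) (g t) (h t)) has_vector_derivative fvec f' g' h') (at t)"
  unfolding fvec_def using assms
  by (auto intro!: has_vector_derivative_add has_vector_derivative_scaleR[THEN has_vector_derivative_eq_rhs] derivative_eq_intros)

lemma act_curve_derivative:
  assumes "X \<in> sl2" "SL2_curve X \<gamma>"
  shows "((\<lambda>t. act (\<gamma> t) w) has_vector_derivative lie_endo B e (sl2_vec X) w) (at 0)"
  unfolding act_def Let_def lie_endo_coord using assms(1)
  by (intro fvec_has_vector_derivative)
    (auto intro!: derivative_eq_intros SL2_curve_entry[OF assms(2)] 
       simp: SL2_curve_0[OF assms(2)] sl2_vec_def sl2_iff field_simps)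

lemma lie_endo_inj: 
  assumes "\<And>w. lie_endo B e u w = lie_endo B e v w" shows "u = v"
  using assms[of "e 2"] assms[of "e 3"] by (simp add: lie_endo_coord vec_eq)

lemma sl2_ident_eq:
  assumes "X \<in> sl2" shows "sl2_ident R B Or Fut e X = sl2_vec X"
  unfolding sl2_ident_def
proof (rule the_equality)
  have hom: "SL2_hom R B Or Fut e (\<gamma> t) = act (\<gamma> t)" if "SL2_curve X \<gamma>" for \<gamma> t
    using that by (intro SL2_hom_eq) (simp add: SL2_curve_def)
  show all: "\<forall>\<gamma>. SL2_curve X \<gamma> \<longrightarrow> (\<forall>w. ((\<lambda>t. SL2_hom R B Or Fut e (\<gamma> t) w) has_vector_derivative
      lie_endo B e (sl2_vec X) w) (at 0))"
    using act_curve_derivative[OF assms] hom by simp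
  obtain \<gamma> where \<gamma>: "SL2_curve X \<gamma>" using SL2_curve_exists[OF assms] by blast
  show "v = sl2_vec X" if v: "\<forall>\<gamma>. SL2_curve X \<gamma> \<longrightarrow> (\<forall>w. ((\<lambda>t. SL2_hom R B Or Fut e (\<gamma> t) w) has_vector_derivative
      lie_endo B e v w) (at 0))" for v
  proof (rule lie_endo_inj)
    show "lie_endo B e v w = lie_endo B e (sl2_vec X) w" for w
      using v all \<gamma> by (intro vector_derivative_unique_at) blast+
  qed
qed

lemma sl2_ident_bij: "bij_betw (sl2_ident R B Or Fut e) sl2 UNIV"
proof -
  have "bij_betw sl2_vec sl2 UNIV"
    by (rule bij_betw_byWitness[where f' = "\<lambda>v. mat2 (- cy v / 2) ((cz v - cx v) / 2) (- (cz v + cx v) / 2) (cy v / 2)"])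
      (auto simp: sl2_vec_def sl2_iff mat2_eq_iff vec_eq field_simps)
  thus ?thesis by (rule bij_betw_cong[THEN iffD1, rotated]) (simp add: sl2_ident_eq)
qed

lemma sl2_ident_linear:
  assumes "X \<in> sl2" "Y \<in> sl2"
  shows "sl2_ident R B Or Fut e (a *\<^sub>R X + b *\<^sub>R Y) = a *\<^sub>R sl2_ident R B Or Fut e X + b *\<^sub>R sl2_ident R B Or Fut e Y"
proof -
  have "a *\<^sub>R X + b *\<^sub>R Y \<in> sl2" using assms by (simp add: sl2_iff)
  thus ?thesis using assms by (simp add: sl2_ident_eq sl2_vec_def vec_eq algebra_simps)
qed

lemma open_half_plane: "open half_plane"
  by (simp add: half_plane_def open_halfspace_Im_gt)

text \<open>
  For \<open>X = ((p, q), (r, -p))\<close> the Hamiltonian is \<open>R (r \<bar>\<xi>\<bar>\<^sup>2 - 2 p Re \<xi> - q) / Im \<xi>\<close> and the generator of the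
  flow is \<open>q + 2 p \<xi> - r \<xi>\<^sup>2\<close>.
\<close>
lemma moment_map: "is_moment_map B (sl2_ident R B Or Fut e) half_plane (half_plane_form R) J"
  unfolding is_moment_map_def
proof (intro ballI)
  fix X \<xi> assume X: "X \<in> sl2" and h: "\<xi> \<in> half_plane"
  have i: "Im \<xi> > 0" using h by (simp add: half_plane_def)
  obtain p q r where p: "X$1$1 = p" "X$1$2 = q" "X$2$1 = r" by blast
  let ?H = "\<lambda>\<zeta>. R * ((- q) + (- 2 * p) * Re \<zeta> + r * ((Re \<zeta>)\<^sup>2 + (Im \<zeta>)\<^sup>2)) / Im \<zeta>"
  have H: "B (J \<zeta>) (sl2_ident R B Or Fut e X) = ?H \<zeta>" if "\<zeta> \<in> half_plane" for \<zeta>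
  proof -
    have "2 * B (J \<zeta>) (sl2_vec X) = 2 * ?H \<zeta>"
      unfolding B_null J_eq_moment_vec[OF that] moment_vec_diff[OF that] moment_vec_sum[OF that, unfolded add.commute[of "cx _"]] cmod_power2
      using that by (simp add: moment_vec_def sl2_vec_def p half_plane_def field_simps)
    thus ?thesis by (simp add: sl2_ident_eq X)
  qed
  have "(?H has_derivative half_plane_form R \<xi> (fundamental_field X \<xi>)) (at \<xi>)"
    unfolding half_plane_form_def fundamental_field_eq[OF X] p
    using i
    by (auto intro!: derivative_eq_intros bounded_linear.has_derivative[OF bounded_linear_Re] 
      bounded_linear.has_derivative[OF bounded_linear_Im] ext simp: field_simps power2_eq_square)
  thus "((\<lambda>\<zeta>. B (J \<zeta>) (sl2_ident R B Or Fut e X)) has_derivative half_plane_form R \<xi> (fundamental_field X \<xi>)) (at \<xi>)"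
    by (rule has_derivative_transform_within_open[OF _ open_half_plane h]) (simp add: H)
qed

end

section \<open>Generalized temperatures\<close>

text \<open>
  A quadratic polynomial that is nowhere positive has nonpositive outer coefficients and a nonpositive
  discriminant, which here means \<open>c \<le> - \<surd>(\<alpha>\<^sup>2 + \<beta>\<^sup>2)\<close>.
\<close>
lemma quadratic_positive_value:
  fixes \<alpha> \<beta> c :: real
  assumes "c > - sqrt (\<alpha>\<^sup>2 + \<beta>\<^sup>2)"
  shows "\<exists>r. (c - \<alpha>) - 2 * \<beta> * r + (c + \<alpha>) * r\<^sup>2 > 0"
proof (rule ccontr)
  assume "\<not> ?thesis"
  hence q: "(c - \<alpha>) - 2 * \<beta> * r + (c + \<alpha>) * r\<^sup>2 \<le> 0" for r by (auto simp: not_less)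
  have c1: "c - \<alpha> \<le> 0" using q[of 0] by simp
  have c2: "c + \<alpha> \<le> 0"
  proof (rule ccontr)
    assume p: "\<not> c + \<alpha> \<le> 0"
    define r where "r = sqrt (1 + (\<alpha> - c) / (c + \<alpha>))"
    have "r\<^sup>2 = 1 + (\<alpha> - c) / (c + \<alpha>)" using p c1 by (simp add: r_def)
    hence "(c + \<alpha>) * r\<^sup>2 = 2 * \<alpha>" using p by (simp add: field_simps)
    with q[of r] q[of "- r"] p show False by simp
  qed
  have "\<beta>\<^sup>2 \<le> (c - \<alpha>) * (c + \<alpha>)"
  proof (cases "c + \<alpha> = 0")
    case True
    have "\<beta> = 0"
    proof (rule ccontr)
      assume "\<beta> \<noteq> 0"
      thus False using q[of "(c - \<alpha> - 1) / (2 * \<beta>)"] True by simp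
    qed
    thus ?thesis using True by simp
  next
    case False
    define p where "p = c + \<alpha>"
    have p: "p < 0" using False c2 by (simp add: p_def)
    have "(c - \<alpha>) - 2 * \<beta> * (\<beta> / p) + p * (\<beta> / p)\<^sup>2 \<le> 0" using q[of "\<beta> / p"] by (simp add: p_def)
    hence "(c - \<alpha>) - \<beta>\<^sup>2 / p \<le> 0" using p by (simp add: power2_eq_square)
    hence "((c - \<alpha>) - \<beta>\<^sup>2 / p) * p \<ge> 0" using p by (intro mult_nonpos_nonpos) auto
    moreover have "((c - \<alpha>) - \<beta>\<^sup>2 / p) * p = (c - \<alpha>) * p - \<beta>\<^sup>2" using p by (simp add: field_simps)
    ultimately show ?thesis by (simp add: p_def)
  qed
  hence "\<alpha>\<^sup>2 + \<beta>\<^sup>2 \<le> (- c)\<^sup>2" by (simp add: power2_eq_square algebra_simps)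
  hence "sqrt (\<alpha>\<^sup>2 + \<beta>\<^sup>2) \<le> - c" using c1 c2 by (intro real_le_lsqrt) auto
  thus False using assms by simp
qed

context half_plane_frame
begin

abbreviation (input) M :: "complex measure" where "M \<equiv> hp_measure R"

lemma J_measurable [measurable]: "J \<in> borel_measurable M"
proof -
  have "moment_vec \<in> borel_measurable borel" unfolding moment_vec_def[abs_def] fvec_def by measurable
  hence "moment_vec \<in> borel_measurable M" by (rule measurable_hp)
  thus ?thesis by (rule measurable_cong[THEN iffD1, rotated]) (simp add: J_eq_moment_vec)
qed

lemma B_measurable [measurable]: "(\<lambda>v. B v \<beta>) \<in> borel_measurable borel"
proof -
  have "bounded_linear (\<lambda>v. B v \<beta>)"
    by (intro linear_conv_bounded_linear[THEN iffD1] linearI; simp add: B_simps)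
  thus ?thesis by (intro borel_measurable_continuous_onI linear_continuous_on)
qed

lemma orbit_norm: "\<xi> \<in> half_plane \<Longrightarrow> sqrt ((cx (J \<xi>))\<^sup>2 + (cy (J \<xi>))\<^sup>2) \<le> height R \<xi>"
  using moment_vec_orbit[of \<xi>] by (simp add: J_eq_moment_vec orbit_iff moment_vec_def)

lemma timelike_past_iff:
  "timelike B \<beta> \<and> past_directed B Fut \<beta> \<longleftrightarrow> cz \<beta> < - sqrt ((cx \<beta>)\<^sup>2 + (cy \<beta>)\<^sup>2)" (is "_ \<longleftrightarrow> _ < - ?s")
proof -
  have "timelike B \<beta> \<longleftrightarrow> ?s\<^sup>2 < (cz \<beta>)\<^sup>2" by (simp add: timelike_def B_coord power2_eq_square)
  moreover have "past_directed B Fut \<beta> \<longleftrightarrow> cz \<beta> < 0 \<and> ?s\<^sup>2 \<le> (cz \<beta>)\<^sup>2"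
    using future_eq[OF component e3_Fut] by (auto simp: past_directed_def causal_cz)
  moreover have "cz \<beta> < - ?s \<longleftrightarrow> cz \<beta> < 0 \<and> ?s\<^sup>2 < (cz \<beta>)\<^sup>2"
  proof -
    have s: "?s \<ge> 0" by simp
    show ?thesis using s power2_less_imp_less[of ?s "- cz \<beta>"] power_strict_mono[of ?s "- cz \<beta>" 2]
      by (auto simp del: real_sqrt_pow2 real_sqrt_ge_0_iff)
  qed
  ultimately show ?thesis by auto
qed

text \<open>
  Since \<open>x\<^sup>2 + y\<^sup>2 \<le> z\<^sup>2\<close> on the orbit, Cauchy-Schwarz bounds the exponent by \<open>z (v\<^sub>z + \<bar>(v\<^sub>x, v\<^sub>y)\<bar>)\<close>, and the
  second factor is at most \<open>-\<epsilon>\<close> on a neighbourhood of a past time-like vector.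
\<close>
lemma timelike_past_generalized:
  assumes "cz \<beta> < - sqrt ((cx \<beta>)\<^sup>2 + (cy \<beta>)\<^sup>2)"
  shows "\<beta> \<in> generalized_temperatures B M J"
proof -
  define \<epsilon> where "\<epsilon> = (- cz \<beta> - sqrt ((cx \<beta>)\<^sup>2 + (cy \<beta>)\<^sup>2)) / 2"
  have eps: "\<epsilon> > 0" using assms by (simp add: \<epsilon>_def)
  define U where "U = {v. cz v + sqrt ((cx v)\<^sup>2 + (cy v)\<^sup>2) < - \<epsilon>}"
  have "open U" unfolding U_def
    using bounded_linear_coord[THEN linear_continuous_on, of UNIV] 
    by (intro open_Collect_less continuous_intros)
  moreover have "\<beta> \<in> U" using assms by (simp add: U_def \<epsilon>_def field_simps)
  moreover have "integrable M (\<lambda>\<xi>. exp (- \<epsilon> * height R \<xi>))"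
  proof -
    have "integrable M (\<lambda>\<xi>. exp (- \<epsilon> * R) * exp (- \<epsilon> * (height R \<xi> - R)))"
      using hp_gibbs_has_integral[OF Rpos eps, of 1 0 0] by (simp add: has_bochner_integral_iff)
    thus ?thesis unfolding exp_add[symmetric] by (simp add: algebra_simps)
  qed
  moreover have "exp (- B (J \<xi>) v) \<le> exp (- \<epsilon> * height R \<xi>)" if v: "v \<in> U" and h: "\<xi> \<in> half_plane" for v \<xi>
  proof -
    let ?z = "height R \<xi>" and ?s = "sqrt ((cx v)\<^sup>2 + (cy v)\<^sup>2)"
    have z: "cz (J \<xi>) = ?z" "?z > 0" using h height_pos by (simp_all add: J_eq_moment_vec moment_vec_def)
    have "- (cx (J \<xi>) * cx v + cy (J \<xi>) * cy v) \<le> sqrt ((cx (J \<xi>))\<^sup>2 + (cy (J \<xi>))\<^sup>2) * ?s"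
      using Cauchy_Schwarz_ineq2[of "Complex (cx (J \<xi>)) (cy (J \<xi>))" "Complex (cx v) (cy v)"]
      by (simp add: inner_complex_def cmod_def)
    also have "\<dots> \<le> ?z * ?s" using orbit_norm[OF h] by (intro mult_right_mono) auto
    finally have "- B (J \<xi>) v \<le> ?z * (cz v + ?s)" using z by (simp add: B_coord algebra_simps)
    also have "\<dots> \<le> ?z * (- \<epsilon>)" using v z(2) by (intro mult_left_mono) (auto simp: U_def)
    finally show ?thesis by (simp add: mult.commute)
  qed
  ultimately show ?thesis unfolding generalized_temperatures_def 
    by (intro CollectI exI[of _ U] exI[of _ "\<lambda>\<xi>. exp (- \<epsilon> * height R \<xi>)"]) auto
qed

text \<open>
  Vectors on the past light cone are excluded through the openness in the definition: moving \<open>\<beta>\<close> slightly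
  in the direction of \<open>e\<^sub>z\<close> makes the inequality strict, and then the weight is at least 1 on a box
  of infinite measure at the real axis.
\<close>
lemma generalized_timelike_past:
  assumes "\<beta> \<in> generalized_temperatures B M J"
  shows "cz \<beta> < - sqrt ((cx \<beta>)\<^sup>2 + (cy \<beta>)\<^sup>2)"
proof (rule ccontr)
  assume not: "\<not> ?thesis"
  obtain U f where U: "open U" "\<beta> \<in> U" and f: "integrable M f" "\<And>\<xi>. \<xi> \<in> half_plane \<Longrightarrow> 0 \<le> f \<xi>"
     and le: "\<And>v \<xi>. v \<in> U \<Longrightarrow> \<xi> \<in> half_plane \<Longrightarrow> exp (- B (J \<xi>) v) \<le> f \<xi>"
    using assms by (auto simp: generalized_temperatures_def)
  obtain \<delta> where \<delta>: "\<delta> > 0" "ball \<beta> \<delta> \<subseteq> U" using U openE by blast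
  define \<eta> where "\<eta> = \<delta> / (2 * (norm (e 3) + 1))"
  define v where "v = \<beta> + \<eta> *\<^sub>R e 3"
  have ne: "norm (e 3) + 1 > 0" by (simp add: add_nonneg_pos)
  have eta: "\<eta> > 0" using \<delta> ne by (simp add: \<eta>_def)
  have "dist \<beta> v = \<eta> * norm (e 3)" using eta by (simp add: v_def dist_norm)
  also have "\<dots> < \<eta> * (2 * (norm (e 3) + 1))" using eta by (intro mult_strict_left_mono) (auto simp: add_nonneg_pos)
  also have "\<dots> = \<delta>" using ne by (simp add: \<eta>_def)
  finally have vU: "v \<in> U" using \<delta> by auto
  define \<alpha> b c where "\<alpha> = cx v" and "b = cy v" and "c = cz v"
  have "c > - sqrt (\<alpha>\<^sup>2 + b\<^sup>2)" using not eta by (simp add: \<alpha>_def b_def c_def v_def)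
  then obtain r where r: "(c - \<alpha>) - 2 * b * r + (c + \<alpha>) * r\<^sup>2 > 0" using quadratic_positive_value by blast
  let ?q = "\<lambda>\<xi>. (c - \<alpha>) - 2 * b * Re \<xi> + (c + \<alpha>) * ((Re \<xi>)\<^sup>2 + (Im \<xi>)\<^sup>2)"
  have "open {\<xi>. 0 < ?q \<xi>}" by (intro open_Collect_less continuous_intros)
  moreover have "Complex r 0 \<in> {\<xi>. 0 < ?q \<xi>}" using r by simp
  ultimately obtain \<rho> where \<rho>: "\<rho> > 0" "ball (Complex r 0) \<rho> \<subseteq> {\<xi>. 0 < ?q \<xi>}" using openE by blast
  define d where "d = \<rho> / 2"
  define A where "A = {\<xi>. \<bar>Re \<xi> - r\<bar> < d \<and> 0 < Im \<xi> \<and> Im \<xi> < d}"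
  have AH: "A \<subseteq> half_plane" by (auto simp: A_def half_plane_def)
  have inf: "emeasure M A = \<infinity>" unfolding A_def using infinite_near_boundary[OF Rpos, of d r] \<rho> by (simp add: d_def)
  have one: "1 \<le> f \<xi>" if A: "\<xi> \<in> A" for \<xi>
  proof -
    have h: "\<xi> \<in> half_plane" using A AH by auto
    have i: "Im \<xi> > 0" using h by (simp add: half_plane_def)
    have "cmod (Complex r 0 - \<xi>) \<le> \<bar>r - Re \<xi>\<bar> + \<bar>Im \<xi>\<bar>" using cmod_le[of "Complex r 0 - \<xi>"] by simp
    also have "\<dots> < \<rho>"
    proof -
      have "\<bar>Re \<xi> - r\<bar> < \<rho> / 2" "0 < Im \<xi>" "Im \<xi> < \<rho> / 2" using A by (simp_all add: A_def d_def)
      thus ?thesis by linarith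
    qed
    finally have "0 < ?q \<xi>" using \<rho> by (auto simp: dist_norm)
    hence q: "0 \<le> (c - \<alpha>) - 2 * b * Re \<xi> + (c + \<alpha>) * (cmod \<xi>)\<^sup>2" by (simp add: cmod_power2)
    have "- 2 * B (J \<xi>) v = (R / Im \<xi>) * ((c - \<alpha>) - 2 * b * Re \<xi> + (c + \<alpha>) * (cmod \<xi>)\<^sup>2)"
      using B_null[of "J \<xi>" v] moment_vec_diff[OF h] moment_vec_sum[OF h] i
      by (simp add: J_eq_moment_vec[OF h] add.commute[of "cz (moment_vec \<xi>)"] flip: \<alpha>_def b_def c_def) (simp add: moment_vec_def field_simps)
    moreover have "\<dots> \<ge> 0" using q i Rpos by (intro mult_nonneg_nonneg) auto
    ultimately have "1 \<le> exp (- B (J \<xi>) v)" by simp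
    thus ?thesis using le[OF vU h] by linarith
  qed
  have "A \<in> sets borel" unfolding A_def by measurable
  hence "A \<in> sets M" unfolding sets_hp using AH by (auto simp: sets_restrict_space_iff)
  hence "emeasure M A = (\<integral>\<^sup>+\<xi>. indicator A \<xi> \<partial>M)" by simp
  also have "\<dots> \<le> (\<integral>\<^sup>+\<xi>. ennreal (f \<xi>) \<partial>M)"
    using one by (intro nn_integral_mono) (auto split: split_indicator simp: ennreal_leI simp flip: ennreal_1)
  also have "\<dots> = ennreal (\<integral>\<xi>. f \<xi> \<partial>M)"
    using f by (intro nn_integral_eq_integral) auto
  finally show False using inf by (simp add: top_unique)
qed

lemma generalized_temperatures_eq:
  "generalized_temperatures B M J = {\<beta>. timelike B \<beta> \<and> past_directed B Fut \<beta>}"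
  using timelike_past_generalized generalized_timelike_past by (auto simp: timelike_past_iff simp del: not_less)

section \<open>Reduction to the rest frame\<close>

text \<open>
  The affine group acts simply transitively on the half-plane, hence on the past unit hyperboloid. The
  matrix is the one of \<open>\<xi> \<mapsto> h \<xi> + t\<close>; comparing null coordinates of \<open>-k e\<^sub>z\<close> and \<open>\<beta>\<close> gives \<open>h\<close> and \<open>t\<close>.
\<close>
lemma rest_frame:
  assumes "cz \<beta> < - sqrt ((cx \<beta>)\<^sup>2 + (cy \<beta>)\<^sup>2)"
  obtains A h t where "A \<in> SL2" "h > 0" "lnorm B \<beta> > 0" "act A (- lnorm B \<beta> *\<^sub>R e 3) = \<beta>"
    "moebius_act A = (\<lambda>\<xi>. Complex (t + h * Re \<xi>) (h * Im \<xi>))"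
proof -
  have tl: "timelike B \<beta>" using assms timelike_past_iff by blast
  define k where "k = lnorm B \<beta>"
  have k: "k > 0" using tl by (simp add: k_def lnorm_def timelike_def)
  have "k\<^sup>2 = - B \<beta> \<beta>" using tl by (simp add: k_def lnorm_def timelike_def)
  hence k2: "(cz \<beta> - cx \<beta>) * (cz \<beta> + cx \<beta>) = k\<^sup>2 + (cy \<beta>)\<^sup>2" 
    by (simp add: B_coord power2_eq_square algebra_simps)
  have "\<bar>cx \<beta>\<bar> \<le> sqrt ((cx \<beta>)\<^sup>2 + (cy \<beta>)\<^sup>2)" by (rule real_le_rsqrt) simp
  define a where "a = - (cz \<beta> + cx \<beta>)"
  have a: "a > 0" using assms \<open>\<bar>cx \<beta>\<bar> \<le> _\<close> unfolding a_def by linarith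
  define t h where "t = - cy \<beta> / a" and "h = k / a"
  have h: "h > 0" using a k by (simp add: h_def)
  define A where "A = mat2 (sqrt h) (t / sqrt h) 0 (1 / sqrt h)"
  have "A \<in> SL2" using h by (simp add: A_def SL2_iff)
  moreover have "moebius_act A = (\<lambda>\<xi>. Complex (t + h * Re \<xi>) (h * Im \<xi>))"
  proof
    fix \<xi>
    have "(of_real (sqrt h) :: complex) \<noteq> 0" "of_real (sqrt h) * of_real (sqrt h) = (of_real h :: complex)"
      using h by (simp_all flip: of_real_mult)
    hence "moebius_act A \<xi> = of_real h * \<xi> + of_real t"
      unfolding moebius_act_def A_def by (simp add: field_simps)
    thus "moebius_act A \<xi> = Complex (t + h * Re \<xi>) (h * Im \<xi>)" by (simp add: complex_eq_iff)
  qed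
  moreover have "act A (- k *\<^sub>R e 3) = \<beta>"
  proof -
    have 1: "h * k + t\<^sup>2 * k / h = - (cz \<beta> - cx \<beta>)"
    proof -
      have "(h * k + t\<^sup>2 * k / h) * a = k\<^sup>2 + (cy \<beta>)\<^sup>2"
        using a k unfolding t_def h_def by (simp add: power2_eq_square field_simps)
      also have "\<dots> = - (cz \<beta> - cx \<beta>) * a" unfolding k2[symmetric] a_def by (simp add: algebra_simps)
      finally show ?thesis using a by simp
    qed
    have 2: "t * k / h = - cy \<beta>" "k / h = - (cz \<beta> + cx \<beta>)"
      using a k by (simp_all add: t_def h_def) (simp add: a_def)
    show ?thesis unfolding vec_eq_null act_null 
      using 1 2 h by (simp add: A_def power_divide power_mult_distrib algebra_simps)
  qed
  ultimately show ?thesis using that[OF _ h] k unfolding k_def by blast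
qed

lemma gibbs_at_rest:
  assumes k: "k > 0" and h: "\<xi> \<in> half_plane"
  shows "B (J \<xi>) (- k *\<^sub>R e 3) = k * height R \<xi>" "gibbs_density B M J (- k *\<^sub>R e 3) \<xi> = rest_density R k \<xi>"
proof -
  have BJ: "B (J \<zeta>) (- k *\<^sub>R e 3) = k * height R \<zeta>" if "\<zeta> \<in> half_plane" for \<zeta>
    using that by (simp add: B_coord J_eq_moment_vec moment_vec_def)
  show "B (J \<xi>) (- k *\<^sub>R e 3) = k * height R \<xi>" by (rule BJ[OF h])
  have "partition_function B M J (- k *\<^sub>R e 3) = (\<integral>\<xi>. exp (- k * R) * exp (- k * (height R \<xi> - R)) \<partial>M)"
    unfolding partition_function_def exp_add[symmetric]
    by (intro Bochner_Integration.integral_cong) (simp_all add: BJ algebra_simps del: scaleR_minus_left)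
  also have "\<dots> = exp (- k * R) * (2 * pi / k)"
    using hp_gibbs_has_integral[OF Rpos k, of 1 0 0] by (simp add: has_bochner_integral_iff)
  finally have P: "partition_function B M J (- k *\<^sub>R e 3) = exp (- k * R) * (2 * pi / k)" .
  have "exp (- k * height R \<xi>) = exp (- k * R) * exp (- k * (height R \<xi> - R))"
    unfolding exp_add[symmetric] by (simp add: algebra_simps)
  thus "gibbs_density B M J (- k *\<^sub>R e 3) \<xi> = rest_density R k \<xi>"
    unfolding gibbs_density_def P BJ[OF h] using k by (simp add: rest_density_def field_simps)
qed

lemma gibbs_measurable [measurable]: "gibbs_density B M J \<beta> \<in> borel_measurable M"
  unfolding gibbs_density_def[abs_def] by measurable

lemma boost_invariant:
  assumes "h > 0" and T: "moebius_act A = (\<lambda>\<xi>. Complex (t + h * Re \<xi>) (h * Im \<xi>))"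
  shows "moebius_act A \<in> measurable M M" "distr M M (moebius_act A) = M"
  using hp_affine_measurable[OF assms(1)] hp_invariant[OF Rpos assms(1)] assms(1) unfolding T by simp_all

lemma boost_integral:
  fixes f :: "complex \<Rightarrow> 'b::{banach, second_countable_topology}"
  assumes "h > 0" "moebius_act A = (\<lambda>\<xi>. Complex (t + h * Re \<xi>) (h * Im \<xi>))"
    and "f \<in> borel_measurable M" "has_bochner_integral M (\<lambda>\<xi>. f (moebius_act A \<xi>)) x"
  shows "has_bochner_integral M f x"
  using has_bochner_integral_distr[OF assms(3) boost_invariant(1)[OF assms(1,2)]] assms(4)
  unfolding boost_invariant(2)[OF assms(1,2)] by blast

text \<open>
  The Moebius map preserves the measure, and it applies the same Lorentz transformation to both
  arguments of the pairing, so it carries one Gibbs state to the other.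
\<close>
lemma boost_gibbs:
  assumes "A \<in> SL2" "h > 0" "k > 0" and T: "moebius_act A = (\<lambda>\<xi>. Complex (t + h * Re \<xi>) (h * Im \<xi>))"
    and \<beta>: "act A (- k *\<^sub>R e 3) = \<beta>" and h: "\<xi> \<in> half_plane"
  shows "gibbs_density B M J \<beta> (moebius_act A \<xi>) = rest_density R k \<xi>"
proof -
  note D = boost_invariant[OF assms(2) T]
  have BJ: "B (J (moebius_act A \<xi>)) \<beta> = B (J \<xi>) (- k *\<^sub>R e 3)" if "\<xi> \<in> half_plane" for \<xi>
    using J_equivariant[OF assms(1) that] act_B[OF assms(1)] unfolding \<beta>[symmetric] by simp
  have "partition_function B M J \<beta> = (\<integral>\<xi>. exp (- B (J \<xi>) \<beta>) \<partial>distr M M (moebius_act A))"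
    unfolding partition_function_def D(2) ..
  also have "\<dots> = (\<integral>\<xi>. exp (- B (J (moebius_act A \<xi>)) \<beta>) \<partial>M)" by (rule integral_distr[OF D(1)]) measurable
  also have "\<dots> = partition_function B M J (- k *\<^sub>R e 3)"
    unfolding partition_function_def by (intro Bochner_Integration.integral_cong) (simp_all add: BJ)
  finally have P: "partition_function B M J \<beta> = partition_function B M J (- k *\<^sub>R e 3)" .
  show ?thesis
    unfolding gibbs_at_rest(2)[OF assms(3) h, symmetric] gibbs_density_def P BJ[OF h] ..
qed

lemma rest_mean_J:
  assumes k: "k > 0"
  shows "has_bochner_integral M (\<lambda>\<xi>. rest_density R k \<xi> *\<^sub>R J \<xi>) ((R + 1 / k) *\<^sub>R e 3)"
proof -
  let ?\<rho> = "rest_density R k"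
  have "has_bochner_integral M (\<lambda>\<xi>. (?\<rho> \<xi> * (R / Im \<xi> - height R \<xi>)) *\<^sub>R e 1 + (?\<rho> \<xi> * (R * Re \<xi> / Im \<xi>)) *\<^sub>R e 2
      + (?\<rho> \<xi> * height R \<xi>) *\<^sub>R e 3) (0 *\<^sub>R e 1 + 0 *\<^sub>R e 2 + (R + 1 / k) *\<^sub>R e 3)"
    by (intro has_bochner_integral_add has_bochner_integral_scaleR_left rest_expectations Rpos k)
  moreover have "?\<rho> \<xi> *\<^sub>R J \<xi> = (?\<rho> \<xi> * (R / Im \<xi> - height R \<xi>)) *\<^sub>R e 1 + (?\<rho> \<xi> * (R * Re \<xi> / Im \<xi>)) *\<^sub>R e 2
      + (?\<rho> \<xi> * height R \<xi>) *\<^sub>R e 3" if "\<xi> \<in> half_plane" for \<xi>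
  proof -
    have "R / Im \<xi> - height R \<xi> = R * (1 - (cmod \<xi>)\<^sup>2) / (2 * Im \<xi>)"
      using moment_vec_sum[OF that] by (simp add: moment_vec_def)
    thus ?thesis by (simp add: vec_eq J_eq_moment_vec[OF that] moment_vec_def)
  qed
  ultimately show ?thesis
    by (subst has_bochner_integral_cong[OF refl]) auto
qed

lemma gibbs_integral:
  assumes "cz \<beta> < - sqrt ((cx \<beta>)\<^sup>2 + (cy \<beta>)\<^sup>2)"
  shows "has_bochner_integral M (gibbs_density B M J \<beta>) 1"
    "has_bochner_integral M (\<lambda>\<xi>. gibbs_density B M J \<beta> \<xi> *\<^sub>R J \<xi>) (- (((1 + R * lnorm B \<beta>) / (lnorm B \<beta>)\<^sup>2) *\<^sub>R \<beta>))"
    "has_bochner_integral M (entropy_integrand B M J \<beta>) (- (1 + ln (2 * pi / lnorm B \<beta>)))"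
proof -
  obtain A h t where A: "A \<in> SL2" and h: "h > 0" and k0: "lnorm B \<beta> > 0" and \<beta>: "act A (- lnorm B \<beta> *\<^sub>R e 3) = \<beta>"
     and T: "moebius_act A = (\<lambda>\<xi>. Complex (t + h * Re \<xi>) (h * Im \<xi>))" by (rule rest_frame[OF assms])
  define k where "k = lnorm B \<beta>"
  have k: "k > 0" using k0 by (simp add: k_def)
  note b = boost_gibbs[OF A h k0 T \<beta>, folded k_def]
  let ?\<rho> = "rest_density R k"
  show "has_bochner_integral M (gibbs_density B M J \<beta>) 1"
  proof (rule boost_integral[OF h T gibbs_measurable])
    show "has_bochner_integral M (\<lambda>\<xi>. gibbs_density B M J \<beta> (moebius_act A \<xi>)) 1"
      using rest_expectations(1)[OF Rpos k] by (subst has_bochner_integral_cong[OF refl]) (auto simp: b)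
  qed
  show "has_bochner_integral M (\<lambda>\<xi>. gibbs_density B M J \<beta> \<xi> *\<^sub>R J \<xi>) (- (((1 + R * lnorm B \<beta>) / (lnorm B \<beta>)\<^sup>2) *\<^sub>R \<beta>))"
  proof (rule boost_integral[OF h T])
    have "bounded_linear (act A)" using linear_act by (simp add: linear_conv_bounded_linear)
    from has_bochner_integral_bounded_linear[OF this rest_mean_J[OF k]]
    have "has_bochner_integral M (\<lambda>\<xi>. ?\<rho> \<xi> *\<^sub>R act A (J \<xi>)) (act A ((R + 1 / k) *\<^sub>R e 3))"
      by (simp add: linear_scale[OF linear_act])
    also have "act A ((R + 1 / k) *\<^sub>R e 3) = - (((1 + R * k) / k\<^sup>2) *\<^sub>R \<beta>)"
    proof -
      have "(R + 1 / k) *\<^sub>R e 3 = (- ((1 + R * k) / k\<^sup>2)) *\<^sub>R (- k *\<^sub>R e 3)"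
        using k by (simp add: power2_eq_square field_simps)
      hence "act A ((R + 1 / k) *\<^sub>R e 3) = (- ((1 + R * k) / k\<^sup>2)) *\<^sub>R act A (- k *\<^sub>R e 3)"
        by (simp only: linear_scale[OF linear_act])
      thus ?thesis unfolding k_def \<beta> by simp
    qed
    finally show "has_bochner_integral M (\<lambda>\<xi>. gibbs_density B M J \<beta> (moebius_act A \<xi>) *\<^sub>R J (moebius_act A \<xi>))
        (- (((1 + R * lnorm B \<beta>) / (lnorm B \<beta>)\<^sup>2) *\<^sub>R \<beta>))"
      unfolding k_def[symmetric]
      by (subst has_bochner_integral_cong[OF refl]) (auto simp: b J_equivariant[OF A])
  qed measurable
  show "has_bochner_integral M (entropy_integrand B M J \<beta>) (- (1 + ln (2 * pi / lnorm B \<beta>)))"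
  proof (rule boost_integral[OF h T])
    have ln: "ln (?\<rho> \<xi>) = (ln (k / (2 * pi)) + k * R) - k * height R \<xi>" for \<xi>
    proof -
      have "ln (?\<rho> \<xi>) = ln (k / (2 * pi)) + ln (exp (- k * (height R \<xi> - R)))"
        unfolding rest_density_def using k by (intro ln_mult_pos) auto
      thus ?thesis by (simp add: algebra_simps)
    qed
    have "has_bochner_integral M (\<lambda>\<xi>. (ln (k / (2 * pi)) + k * R) * ?\<rho> \<xi> - k * (?\<rho> \<xi> * height R \<xi>))
      ((ln (k / (2 * pi)) + k * R) * 1 - k * (R + 1 / k))"
      by (intro has_bochner_integral_diff has_bochner_integral_mult_right rest_expectations Rpos k)
    also have "(ln (k / (2 * pi)) + k * R) * 1 - k * (R + 1 / k) = - (1 + ln (2 * pi / k))"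
      using k by (simp add: ln_div algebra_simps)
    finally show "has_bochner_integral M (\<lambda>\<xi>. entropy_integrand B M J \<beta> (moebius_act A \<xi>)) (- (1 + ln (2 * pi / lnorm B \<beta>)))"
      unfolding k_def[symmetric]
      by (subst has_bochner_integral_cong[OF refl]) (auto simp: b entropy_integrand_def ln algebra_simps)
  qed (unfold entropy_integrand_def, measurable)
qed

lemma gibbs_prob_space:
  assumes "cz \<beta> < - sqrt ((cx \<beta>)\<^sup>2 + (cy \<beta>)\<^sup>2)"
  shows "prob_space (density M (\<lambda>\<xi>. ennreal (gibbs_density B M J \<beta> \<xi>)))"
proof (rule prob_spaceI)
  let ?g = "gibbs_density B M J \<beta>"
  have "partition_function B M J \<beta> \<ge> 0" unfolding partition_function_def by (rule Bochner_Integration.integral_nonneg) simp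
  hence "?g \<xi> \<ge> 0" for \<xi> by (simp add: gibbs_density_def)
  hence "(\<integral>\<^sup>+\<xi>. ennreal (?g \<xi>) \<partial>M) = 1"
    using gibbs_integral(1)[OF assms] by (subst nn_integral_eq_integral) (auto simp: has_bochner_integral_iff)
  moreover have "emeasure (density M (\<lambda>\<xi>. ennreal (?g \<xi>))) half_plane = (\<integral>\<^sup>+\<xi>. ennreal (?g \<xi>) * indicator half_plane \<xi> \<partial>M)"
    using sets.top[of M] by (intro emeasure_density) simp_all
  moreover have "\<dots> = (\<integral>\<^sup>+\<xi>. ennreal (?g \<xi>) \<partial>M)" by (intro nn_integral_cong) simp
  ultimately show "emeasure (density M (\<lambda>\<xi>. ennreal (?g \<xi>))) (space (density M (\<lambda>\<xi>. ennreal (?g \<xi>)))) = 1" by simp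
qed

lemma gibbs_rest_formula:
  assumes "b < 0" "\<xi> \<in> half_plane"
  shows "gibbs_density B M J (b *\<^sub>R e 3) \<xi> = \<bar>b\<bar> / (2 * pi) * exp (- (R * \<bar>b\<bar> * ((1 - Im \<xi>)\<^sup>2 + (Re \<xi>)\<^sup>2) / (2 * Im \<xi>)))"
proof -
  have i: "Im \<xi> > 0" using assms by (simp add: half_plane_def)
  have "height R \<xi> - R = R * ((1 - Im \<xi>)\<^sup>2 + (Re \<xi>)\<^sup>2) / (2 * Im \<xi>)"
    unfolding height_def cmod_power2 using i by (simp add: field_simps power2_eq_square)
  moreover have "gibbs_density B M J (b *\<^sub>R e 3) \<xi> = rest_density R (- b) \<xi>"
    using gibbs_at_rest(2)[of "- b", OF _ assms(2)] assms(1) by simp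
  ultimately show ?thesis using assms(1) by (simp add: rest_density_def mult_ac)
qed

text \<open>The Lorentz transformation that moves \<open>-k e\<^sub>z\<close> to \<open>\<beta>\<close> moves the admissible basis to an adapted one.\<close>
lemma adapted_basis:
  assumes "cz \<beta> < - sqrt ((cx \<beta>)\<^sup>2 + (cy \<beta>)\<^sup>2)"
  shows "\<exists>e'. admissible_basis B Or Fut e' \<and> (\<exists>b<0. \<beta> = b *\<^sub>R e' 3)"
proof -
  obtain A where A: "A \<in> SL2" "lnorm B \<beta> > 0" "act A (- lnorm B \<beta> *\<^sub>R e 3) = \<beta>" by (rule rest_frame[OF assms])
  have "\<beta> = (- lnorm B \<beta>) *\<^sub>R (act A \<circ> e) 3" using A(3) linear_scale[OF linear_act] by (metis comp_apply)
  thus ?thesis using act_admissible[OF A(1) orientation admissible component] A(2) by (metis neg_less_0_iff_less)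
qed

end

theorem mainTheorem4:
  fixes B :: "'f::euclidean_space \<Rightarrow> 'f \<Rightarrow> real"
    and Or :: "(3 \<Rightarrow> 'f) set" and Fut :: "'f set"
    and R :: real and e :: "3 \<Rightarrow> 'f"
  defines "\<iota> \<equiv> sl2_ident R B Or Fut e"
    and "J \<equiv> J_half_plane R B e"
    and "\<omega> \<equiv> half_plane_form R"
  defines "M \<equiv> liouville_measure half_plane \<omega>"
  defines "\<Omega> \<equiv> generalized_temperatures B M J"
  assumes "lorentz_space B Or Fut"
    and "R > 0"
    and "admissible_basis B Or Fut e"
  shows
    "bij_betw \<iota> sl2 UNIV \<and>
     (\<forall>X\<in>sl2. \<forall>Y\<in>sl2. \<forall>a b. \<iota> (a *\<^sub>R X + b *\<^sub>R Y) = a *\<^sub>R \<iota> X + b *\<^sub>R \<iota> Y) \<and>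
     bij_betw (U_M \<circ> psi R B e) (orbit_P R e) half_plane \<and>
     is_moment_map B \<iota> half_plane \<omega> J \<and>
     (\<forall>\<xi>\<in>half_plane. J \<xi> = (R / (2 * Im \<xi>)) *\<^sub>R
        ((1 - (cmod \<xi>)\<^sup>2) *\<^sub>R e 1 + (2 * Re \<xi>) *\<^sub>R e 2 + (1 + (cmod \<xi>)\<^sup>2) *\<^sub>R e 3)) \<and>
     \<Omega> = {\<beta>. timelike B \<beta> \<and> past_directed B Fut \<beta>} \<and>
     (\<forall>\<beta>\<in>\<Omega>. \<exists>e'. admissible_basis B Or Fut e' \<and> (\<exists>b<0. \<beta> = b *\<^sub>R e' 3)) \<and>
     (\<forall>\<beta>\<in>\<Omega>. prob_space (density M (\<lambda>\<xi>. ennreal (gibbs_density B M J \<beta> \<xi>)))) \<and>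
     (\<forall>\<beta>\<in>\<Omega>. \<forall>b<0. \<beta> = b *\<^sub>R e 3 \<longrightarrow> lnorm B \<beta> = \<bar>b\<bar> \<and>
        (\<forall>\<xi>\<in>half_plane. gibbs_density B M J \<beta> \<xi> =
           \<bar>b\<bar> / (2 * pi) * exp (- (R * \<bar>b\<bar> * ((1 - Im \<xi>)\<^sup>2 + (Re \<xi>)\<^sup>2) / (2 * Im \<xi>))))) \<and>
     (\<forall>\<beta>\<in>\<Omega>. integrable M (\<lambda>\<xi>. gibbs_density B M J \<beta> \<xi> *\<^sub>R J \<xi>) \<and>
        mean_moment B M J \<beta> = - (((1 + R * lnorm B \<beta>) / (lnorm B \<beta>)\<^sup>2) *\<^sub>R \<beta>)) \<and>
     (\<forall>\<beta>\<in>\<Omega>. integrable M (entropy_integrand B M J \<beta>) \<and>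
        gibbs_entropy B M J \<beta> = 1 + ln (2 * pi / lnorm B \<beta>))"
proof -
  from assms(6) have space: "bilinear B" "\<And>u v. B u v = B v u" "is_orientation Or" "Fut \<in> components (causal_vectors B)"
    by (auto simp: lorentz_space_def)
  interpret half_plane_frame B e R Or Fut
    using space assms(7,8) by unfold_locales (auto simp: admissible_basis_def)
  have \<Omega>: "\<Omega> = {\<beta>. timelike B \<beta> \<and> past_directed B Fut \<beta>}"
    unfolding \<Omega>_def M_def J_def \<omega>_def by (rule generalized_temperatures_eq)
  have tp: "cz \<beta> < - sqrt ((cx \<beta>)\<^sup>2 + (cy \<beta>)\<^sup>2)" if "\<beta> \<in> \<Omega>" for \<beta>
    using that timelike_past_iff unfolding \<Omega> by blast
  have lnorm: "lnorm B (b *\<^sub>R e 3) = \<bar>b\<bar>" for b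
    by (simp add: lnorm_def B_coord)
  note I = gibbs_integral[OF tp, unfolded has_bochner_integral_iff]
  show ?thesis
  proof (intro conjI ballI allI impI)
    show "bij_betw \<iota> sl2 UNIV" unfolding \<iota>_def by (rule sl2_ident_bij)
    show "\<iota> (a *\<^sub>R X + b *\<^sub>R Y) = a *\<^sub>R \<iota> X + b *\<^sub>R \<iota> Y" if "X \<in> sl2" "Y \<in> sl2" for X Y a b
      unfolding \<iota>_def using that by (rule sl2_ident_linear)
    show "bij_betw (U_M \<circ> psi R B e) (orbit_P R e) half_plane" by (rule chart_bij)
    show "is_moment_map B \<iota> half_plane \<omega> J" unfolding \<iota>_def \<omega>_def J_def by (rule moment_map)
    show "J \<xi> = (R / (2 * Im \<xi>)) *\<^sub>R ((1 - (cmod \<xi>)\<^sup>2) *\<^sub>R e 1 + (2 * Re \<xi>) *\<^sub>R e 2 + (1 + (cmod \<xi>)\<^sup>2) *\<^sub>R e 3)"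
      if "\<xi> \<in> half_plane" for \<xi>
      unfolding J_def using that by (rule J_formula)
    show "\<Omega> = {\<beta>. timelike B \<beta> \<and> past_directed B Fut \<beta>}" by (rule \<Omega>)
  next
    fix \<beta> assume \<beta>: "\<beta> \<in> \<Omega>"
    show "\<exists>e'. admissible_basis B Or Fut e' \<and> (\<exists>b<0. \<beta> = b *\<^sub>R e' 3)" by (rule adapted_basis[OF tp[OF \<beta>]])
    show "prob_space (density M (\<lambda>\<xi>. ennreal (gibbs_density B M J \<beta> \<xi>)))"
      unfolding M_def J_def \<omega>_def by (rule gibbs_prob_space[OF tp[OF \<beta>]])
    show "integrable M (\<lambda>\<xi>. gibbs_density B M J \<beta> \<xi> *\<^sub>R J \<xi>)"
      "mean_moment B M J \<beta> = - (((1 + R * lnorm B \<beta>) / (lnorm B \<beta>)\<^sup>2) *\<^sub>R \<beta>)"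
      "integrable M (entropy_integrand B M J \<beta>)" "gibbs_entropy B M J \<beta> = 1 + ln (2 * pi / lnorm B \<beta>)"
      using I[OF \<beta>] unfolding M_def J_def \<omega>_def mean_moment_def gibbs_entropy_def by simp_all
  next
    fix \<beta> b assume "b < 0" "\<beta> = b *\<^sub>R e 3"
    thus "lnorm B \<beta> = \<bar>b\<bar>" by (simp add: lnorm)
  next
    fix \<beta> b \<xi> assume "b < 0" "\<beta> = b *\<^sub>R e 3" "\<xi> \<in> half_plane"
    thus "gibbs_density B M J \<beta> \<xi> =
           \<bar>b\<bar> / (2 * pi) * exp (- (R * \<bar>b\<bar> * ((1 - Im \<xi>)\<^sup>2 + (Re \<xi>)\<^sup>2) / (2 * Im \<xi>)))"
      unfolding M_def J_def \<omega>_def by (simp only: gibbs_rest_formula)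
  qed
qed

end
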